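(* Let $\Gamma$ be a countable sofic group with a sofic approximation $\Sigma$, and let $\pi\colon X\to Y$ be a factor map between dynamical systems $\Gamma\curvearrowright X$ and $\Gamma\curvearrowright Y$. For any compatible metric $\rho_X$ on $X$, $$\mathrm{mdim}_\Sigma(\pi)\le\mathrm{mdim}_{\Sigma,\mathrm M}(X|Y,\rho_X).$$ In particular, if $h_\Sigma(X|Y)<\infty$, then $\mathrm{mdim}_\Sigma(\pi)\le0$.
   Context: $\Gamma$ is a countable discrete group; $\mathcal F(\Gamma)$ is the collection of nonempty finite subsets of $\Gamma$. A dynamical system $\Gamma\curvearrowright X$ is a continuous action on a compact metrizable space $X$; a factor map is a surjective continuous $\Gamma$-equivariant map. $[d]=\{1,\dots,d\}$. A compatible metric is one inducing the topology. $\dim$ is covering dimension. A pseudometric $\rho$ on $X$ is dynamically generating if $\sup_{s\in\Gamma}\rho(sx,sx')>0$ for all distinct $x,x'\in X$. Sofic approximation: a sequence of maps $\Sigma=\{\sigma_i\colon\Gamma\to\mathrm{Sym}(d_i)\}_{i\in\mathbb N}$ (not necessarily homomorphisms; write $\sigma_{i,s}=\sigma_i(s)$) with (1) $|\{v\in[d_i]:\sigma_{i,s}\sigma_{i,t}(v)=\sigma_{i,st}(v)\}|/d_i\to1$ for all $s,t\in\Gamma$; (2) $|\{v\in[d_i]:\sigma_{i,s}(v)\ne\sigma_{i,t}(v)\}|/d_i\to1$ for all distinct $s,t$; (3) $d_i\to\infty$. $\Gamma$ is sofic if it has a sofic approximation. For a continuous pseudometric $\rho$ on $Z$ and $\varphi,\psi\in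 Z^{[d]}$: $\rho_{2}(\varphi,\psi)=\big(\frac1d\sum_{v}\rho(\varphi(v),\psi(v))^2\big)^{1/2}$, $\rho_{\infty}(\varphi,\psi)=\max_v\rho(\varphi(v),\psi(v))$; these are written $\rho_{X,2},\rho_{X,\infty}$ for $\rho=\rho_X$, etc. For $F\in\mathcal F(\Gamma)$, $\delta>0$, $\sigma\colon\Gamma\to\mathrm{Sym}(d)$, $$\mathrm{Map}(\rho_X,F,\delta,\sigma)=\{\varphi\colon[d]\to X:\ \rho_{X,2}(s\varphi,\varphi\circ\sigma(s))\le\delta\ \text{for all } s\in F\},\quad (s\varphi)(v)=s(\varphi(v)).$$ In all definitions below, the $\limsup$ is $-\infty$ if the $\mathrm{Map}$ sets are empty for all large $i$. Relative sofic mean dimension: for a space $\mathcal K$ with a continuous pseudometric $\rho$, $\mathrm{Wdim}_\varepsilon(\mathcal K,\rho)$ is the minimal $\dim P$ over compact metrizable $P$ admitting a continuous $f\colon\mathcal K\to P$ with $\rho(\varphi,\varphi')<\varepsilon$ whenever $f(\varphi)=f(\varphi')$. With $\pi^d\colon X^{[d]}\to Y^{[d]}$, $\varphi\mapsto\pi\circ\varphi$, and $\rho_X$ a compatible metric on $X$ (the value does not depend on it), $$\mathrm{mdim}_\Sigma(\pi)=\sup_{\varepsilon>0}\inf_{F\in\mathcal F(\Gamma)}\inf_{\delta>0}\limsup_{i\to\infty}\frac1{d_i}\sup_{\psi\in Y^{[d_i]}}\mathrm{Wdim}_\varepsilon\big(\mathrm{Map}(\rho_X,F,\delta,\sigma_i)\cap(\pi^{d_i})^{-1}(\psi),\rho_{X,\infty}\big).$$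 Conditional entropy and metric mean dimension: for $\mathcal K\subseteq X^{[d]}$ and $\varepsilon,\theta>0$, $N_\varepsilon(\mathcal K,\theta,\rho_{X,\infty}|\rho_{Y,\infty})$ is the maximal cardinality of a subset $\mathcal E\subseteq\mathcal K$ such that $\rho_{Y,\infty}(\pi\circ\varphi,\pi\circ\varphi')\le\theta$ and $\rho_{X,\infty}(\varphi,\varphi')\ge\varepsilon$ for all distinct $\varphi,\varphi'\in\mathcal E$. Set $$h_\Sigma^\varepsilon(\rho_X|\rho_Y)=\inf_{\theta>0}\inf_{F\in\mathcal F(\Gamma)}\inf_{\delta>0}\limsup_{i\to\infty}\tfrac1{d_i}\log N_\varepsilon(\mathrm{Map}(\rho_X,F,\delta,\sigma_i),\theta,\rho_{X,\infty}|\rho_{Y,\infty}).$$ For dynamically generating continuous pseudometrics $\rho_X,\rho_Y$ on $X,Y$: $h_\Sigma(X|Y)=\sup_{\varepsilon>0}h_\Sigma^\varepsilon(\rho_X|\rho_Y)$ (independent of $\rho_X,\rho_Y$), and $$\mathrm{mdim}_{\Sigma,\mathrm M}(X|Y,\rho_X)=\liminf_{\varepsilon\to0}\frac{h_\Sigma^\varepsilon(\rho_X|\rho_Y)}{\log(1/\varepsilon)},$$ which does not depend on $\rho_Y$. *)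

theory Defs
  imports "HOL-Analysis.Analysis" "HOL-Algebra.Group_Action"
begin

section \<open>Dynamical systems, metrics and factor maps\<close>

text \<open>\<open>\<Gamma>\<close> is discrete, so an action is continuous iff every group element acts continuously.
  As usual for \<^locale>\<open>group_action\<close>, each \<open>\<alpha> s\<close> is a bijection of \<open>topspace X\<close>, undefined outside.\<close>

definition dynamical_system :: "('g, 'm) monoid_scheme \<Rightarrow> 'x topology \<Rightarrow> ('g \<Rightarrow> 'x \<Rightarrow> 'x) \<Rightarrow> bool" where
  "dynamical_system \<Gamma> X \<alpha> \<longleftrightarrow>
     compact_space X \<and> metrizable_space X \<and> group_action \<Gamma> (topspace X) \<alpha> \<and>
     (\<forall>s\<in>carrier \<Gamma>. continuous_map X X (\<alpha> s))"

definition factor_map ::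
  "('g, 'm) monoid_scheme \<Rightarrow> 'x topology \<Rightarrow> ('g \<Rightarrow> 'x \<Rightarrow> 'x) \<Rightarrow>
   'y topology \<Rightarrow> ('g \<Rightarrow> 'y \<Rightarrow> 'y) \<Rightarrow> ('x \<Rightarrow> 'y) \<Rightarrow> bool" where
  "factor_map \<Gamma> X \<alpha> Y \<beta> \<pi> \<longleftrightarrow>
     continuous_map X Y \<pi> \<and> \<pi> ` topspace X = topspace Y \<and>
     (\<forall>s\<in>carrier \<Gamma>. \<forall>x\<in>topspace X. \<pi> (\<alpha> s x) = \<beta> s (\<pi> x))"

definition compatible_metric :: "'x topology \<Rightarrow> ('x \<Rightarrow> 'x \<Rightarrow> real) \<Rightarrow> bool" where
  "compatible_metric X \<rho> \<longleftrightarrow>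
     Metric_space (topspace X) \<rho> \<and> Metric_space.mtopology (topspace X) \<rho> = X"

definition continuous_pseudometric :: "'x topology \<Rightarrow> ('x \<Rightarrow> 'x \<Rightarrow> real) \<Rightarrow> bool" where
  "continuous_pseudometric X \<rho> \<longleftrightarrow>
     (\<forall>x\<in>topspace X. \<rho> x x = 0) \<and>
     (\<forall>x\<in>topspace X. \<forall>y\<in>topspace X. 0 \<le> \<rho> x y \<and> \<rho> x y = \<rho> y x) \<and>
     (\<forall>x\<in>topspace X. \<forall>y\<in>topspace X. \<forall>z\<in>topspace X. \<rho> x z \<le> \<rho> x y + \<rho> y z) \<and>
     continuous_map (prod_topology X X) euclideanreal (\<lambda>(x, y). \<rho> x y)"

definition dynamically_generating ::
  "('g, 'm) monoid_scheme \<Rightarrow> 'x topology \<Rightarrow> ('g \<Rightarrow> 'x \<Rightarrow> 'x) \<Rightarrow> ('x \<Rightarrow> 'x \<Rightarrow> real) \<Rightarrow> bool" where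
  "dynamically_generating \<Gamma> X \<alpha> \<rho> \<longleftrightarrow>
     (\<forall>x\<in>topspace X. \<forall>x'\<in>topspace X. x \<noteq> x' \<longrightarrow>
        (SUP s\<in>carrier \<Gamma>. ereal (\<rho> (\<alpha> s x) (\<alpha> s x'))) > 0)"

section \<open>Sofic approximations and approximately equivariant maps\<close>

text \<open>\<open>Sym(d)\<close> is the set of permutations of \<open>{1..d}\<close>. As \<open>d i\<close> tends to infinity, the values
  \<open>d i = 0\<close>, which are not excluded, occur finitely often and affect no limit below.\<close>

definition sofic_approximation ::
  "('g, 'm) monoid_scheme \<Rightarrow> (nat \<Rightarrow> nat) \<Rightarrow> (nat \<Rightarrow> 'g \<Rightarrow> nat \<Rightarrow> nat) \<Rightarrow> bool" where
  "sofic_approximation \<Gamma> d \<sigma> \<longleftrightarrow>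
     (\<forall>i. \<forall>s\<in>carrier \<Gamma>. \<sigma> i s permutes {1..d i}) \<and>
     (\<forall>s\<in>carrier \<Gamma>. \<forall>t\<in>carrier \<Gamma>.
        (\<lambda>i. real (card {v\<in>{1..d i}. \<sigma> i s (\<sigma> i t v) = \<sigma> i (s \<otimes>\<^bsub>\<Gamma>\<^esub> t) v}) / real (d i))
          \<longlonglongrightarrow> 1) \<and>
     (\<forall>s\<in>carrier \<Gamma>. \<forall>t\<in>carrier \<Gamma>. s \<noteq> t \<longrightarrow>
        (\<lambda>i. real (card {v\<in>{1..d i}. \<sigma> i s v \<noteq> \<sigma> i t v}) / real (d i)) \<longlonglongrightarrow> 1) \<and>
     filterlim d at_top sequentially"

definition finite_subsets :: "('g, 'm) monoid_scheme \<Rightarrow> 'g set set" where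
  "finite_subsets \<Gamma> = {F. F \<subseteq> carrier \<Gamma> \<and> finite F \<and> F \<noteq> {}}"

definition rho_2 :: "nat \<Rightarrow> ('x \<Rightarrow> 'x \<Rightarrow> real) \<Rightarrow> (nat \<Rightarrow> 'x) \<Rightarrow> (nat \<Rightarrow> 'x) \<Rightarrow> real" where
  "rho_2 n \<rho> \<phi> \<psi> = sqrt (1 / real n * (\<Sum>v\<in>{1..n}. (\<rho> (\<phi> v) (\<psi> v))\<^sup>2))"

definition rho_inf :: "nat \<Rightarrow> ('x \<Rightarrow> 'x \<Rightarrow> real) \<Rightarrow> (nat \<Rightarrow> 'x) \<Rightarrow> (nat \<Rightarrow> 'x) \<Rightarrow> real" where
  "rho_inf n \<rho> \<phi> \<psi> = (MAX v\<in>{1..n}. \<rho> (\<phi> v) (\<psi> v))"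

text \<open>The power \<open>X\<^sup>[\<^sup>n\<^sup>]\<close>: its points are the extensional functions from \<open>{1..n}\<close> to \<open>X\<close>.\<close>

definition power_space :: "'x topology \<Rightarrow> nat \<Rightarrow> (nat \<Rightarrow> 'x) topology" where
  "power_space X n = product_topology (\<lambda>_. X) {1..n}"

definition Map_sofic ::
  "'x topology \<Rightarrow> ('g \<Rightarrow> 'x \<Rightarrow> 'x) \<Rightarrow> ('x \<Rightarrow> 'x \<Rightarrow> real) \<Rightarrow> 'g set \<Rightarrow> real \<Rightarrow>
   nat \<Rightarrow> ('g \<Rightarrow> nat \<Rightarrow> nat) \<Rightarrow> (nat \<Rightarrow> 'x) set" where
  "Map_sofic X \<alpha> \<rho> F \<delta> n \<tau> =
     {\<phi> \<in> topspace (power_space X n). \<forall>s\<in>F. rho_2 n \<rho> (\<lambda>v. \<alpha> s (\<phi> v)) (\<phi> \<circ> \<tau> s) \<le> \<delta>}"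

text \<open>The convention that a limsup is \<open>-\<infinity>\<close> if the sets \<open>K i\<close> underlying the sequence \<open>a\<close> are
  empty for all large \<open>i\<close>.\<close>

definition limsup_conv :: "(nat \<Rightarrow> 'a set) \<Rightarrow> (nat \<Rightarrow> ereal) \<Rightarrow> ereal" where
  "limsup_conv K a = (if \<forall>\<^sub>F i in sequentially. K i = {} then -\<infinity> else limsup a)"

section \<open>Covering dimension and relative sofic mean dimension\<close>

text \<open>The least \<open>n \<ge> -1\<close> such that every finite open cover has a finite open refinement of order
  at most \<open>n\<close>, or \<open>\<infinity>\<close>; the empty space has dimension \<open>-1\<close>.\<close>

definition covering_dim :: "'p topology \<Rightarrow> ereal" where
  "covering_dim P = Inf {ereal (of_int n) | n::int. -1 \<le> n \<and>
     (\<forall>\<U>. finite \<U> \<and> (\<forall>U\<in>\<U>. openin P U) \<and> \<Union>\<U> = topspace P \<longrightarrow>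
        (\<exists>\<V>. finite \<V> \<and> (\<forall>V\<in>\<V>. openin P V) \<and> \<Union>\<V> = topspace P \<and>
             (\<forall>V\<in>\<V>. \<exists>U\<in>\<U>. V \<subseteq> U) \<and>
             (\<forall>x\<in>topspace P. int (card {V\<in>\<V>. x \<in> V}) \<le> n + 1)))}"

text \<open>A compact metrizable space has at most the cardinality of the continuum, hence is
  homeomorphic to a topology whose points have type \<open>nat \<Rightarrow> real\<close>; restricting \<open>P\<close> to such
  topologies is no loss of generality.\<close>

definition Wdim :: "real \<Rightarrow> 'k topology \<Rightarrow> ('k \<Rightarrow> 'k \<Rightarrow> real) \<Rightarrow> ereal" where
  "Wdim \<epsilon> K \<rho> = Inf {covering_dim P | P :: (nat \<Rightarrow> real) topology.
     compact_space P \<and> metrizable_space P \<and>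
     (\<exists>f. continuous_map K P f \<and>
          (\<forall>\<phi>\<in>topspace K. \<forall>\<phi>'\<in>topspace K. f \<phi> = f \<phi>' \<longrightarrow> \<rho> \<phi> \<phi>' < \<epsilon>))}"

definition fibre :: "'x topology \<Rightarrow> ('x \<Rightarrow> 'y) \<Rightarrow> nat \<Rightarrow> (nat \<Rightarrow> 'y) \<Rightarrow> (nat \<Rightarrow> 'x) set" where
  "fibre X \<pi> n \<psi> = {\<phi> \<in> topspace (power_space X n). compose {1..n} \<pi> \<phi> = \<psi>}"

text \<open>The value does not depend on the compatible metric \<open>\<rho>\<close> on \<open>X\<close>, which is kept as an argument.\<close>

definition mdim_sofic ::
  "('g, 'm) monoid_scheme \<Rightarrow> (nat \<Rightarrow> nat) \<Rightarrow> (nat \<Rightarrow> 'g \<Rightarrow> nat \<Rightarrow> nat) \<Rightarrow>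
   'x topology \<Rightarrow> ('g \<Rightarrow> 'x \<Rightarrow> 'x) \<Rightarrow> 'y topology \<Rightarrow> ('x \<Rightarrow> 'y) \<Rightarrow> ('x \<Rightarrow> 'x \<Rightarrow> real) \<Rightarrow> ereal" where
  "mdim_sofic \<Gamma> d \<sigma> X \<alpha> Y \<pi> \<rho> =
     (SUP \<epsilon>\<in>{0<..}. INF F\<in>finite_subsets \<Gamma>. INF \<delta>\<in>{0<..}.
        limsup_conv (\<lambda>i. Map_sofic X \<alpha> \<rho> F \<delta> (d i) (\<sigma> i))
          (\<lambda>i. ereal (1 / real (d i)) *
             (SUP \<psi>\<in>topspace (power_space Y (d i)).
                Wdim \<epsilon>
                  (subtopology (power_space X (d i))
                     (Map_sofic X \<alpha> \<rho> F \<delta> (d i) (\<sigma> i) \<inter> fibre X \<pi> (d i) \<psi>))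
                  (rho_inf (d i) \<rho>))))"

section \<open>Conditional entropy and conditional metric mean dimension\<close>

text \<open>The supremum ranges over finite \<open>E\<close>, so it is the maximal cardinality if there is one and
  \<open>\<infinity>\<close> otherwise.\<close>

definition sep_number ::
  "nat \<Rightarrow> ('x \<Rightarrow> 'y) \<Rightarrow> ('x \<Rightarrow> 'x \<Rightarrow> real) \<Rightarrow> ('y \<Rightarrow> 'y \<Rightarrow> real) \<Rightarrow>
   (nat \<Rightarrow> 'x) set \<Rightarrow> real \<Rightarrow> real \<Rightarrow> ereal" where
  "sep_number n \<pi> \<rho>X \<rho>Y K \<epsilon> \<theta> =
     Sup {ereal (real (card E)) | E. finite E \<and> E \<subseteq> K \<and>
       (\<forall>\<phi>\<in>E. \<forall>\<phi>'\<in>E. \<phi> \<noteq> \<phi>' \<longrightarrow>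
          rho_inf n \<rho>Y (\<pi> \<circ> \<phi>) (\<pi> \<circ> \<phi>') \<le> \<theta> \<and> rho_inf n \<rho>X \<phi> \<phi>' \<ge> \<epsilon>)}"

definition log_ereal :: "ereal \<Rightarrow> ereal" where
  "log_ereal x = (if x \<le> 0 then -\<infinity> else if x = \<infinity> then \<infinity> else ereal (ln (real_of_ereal x)))"

definition cond_entropy_eps ::
  "('g, 'm) monoid_scheme \<Rightarrow> (nat \<Rightarrow> nat) \<Rightarrow> (nat \<Rightarrow> 'g \<Rightarrow> nat \<Rightarrow> nat) \<Rightarrow>
   'x topology \<Rightarrow> ('g \<Rightarrow> 'x \<Rightarrow> 'x) \<Rightarrow> ('x \<Rightarrow> 'y) \<Rightarrow>
   ('x \<Rightarrow> 'x \<Rightarrow> real) \<Rightarrow> ('y \<Rightarrow> 'y \<Rightarrow> real) \<Rightarrow> real \<Rightarrow> ereal" where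
  "cond_entropy_eps \<Gamma> d \<sigma> X \<alpha> \<pi> \<rho>X \<rho>Y \<epsilon> =
     (INF \<theta>\<in>{0<..}. INF F\<in>finite_subsets \<Gamma>. INF \<delta>\<in>{0<..}.
        limsup_conv (\<lambda>i. Map_sofic X \<alpha> \<rho>X F \<delta> (d i) (\<sigma> i))
          (\<lambda>i. ereal (1 / real (d i)) *
             log_ereal (sep_number (d i) \<pi> \<rho>X \<rho>Y (Map_sofic X \<alpha> \<rho>X F \<delta> (d i) (\<sigma> i)) \<epsilon> \<theta>)))"

text \<open>The next value does not depend on the dynamically generating continuous pseudometrics
  \<open>\<rho>X\<close> and \<open>\<rho>Y\<close>, and the one after it does not depend on \<open>\<rho>Y\<close>; they are kept as arguments.\<close>

definition cond_entropy ::
  "('g, 'm) monoid_scheme \<Rightarrow> (nat \<Rightarrow> nat) \<Rightarrow> (nat \<Rightarrow> 'g \<Rightarrow> nat \<Rightarrow> nat) \<Rightarrow>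
   'x topology \<Rightarrow> ('g \<Rightarrow> 'x \<Rightarrow> 'x) \<Rightarrow> ('x \<Rightarrow> 'y) \<Rightarrow>
   ('x \<Rightarrow> 'x \<Rightarrow> real) \<Rightarrow> ('y \<Rightarrow> 'y \<Rightarrow> real) \<Rightarrow> ereal" where
  "cond_entropy \<Gamma> d \<sigma> X \<alpha> \<pi> \<rho>X \<rho>Y =
     (SUP \<epsilon>\<in>{0<..}. cond_entropy_eps \<Gamma> d \<sigma> X \<alpha> \<pi> \<rho>X \<rho>Y \<epsilon>)"

definition cond_metric_mdim ::
  "('g, 'm) monoid_scheme \<Rightarrow> (nat \<Rightarrow> nat) \<Rightarrow> (nat \<Rightarrow> 'g \<Rightarrow> nat \<Rightarrow> nat) \<Rightarrow>
   'x topology \<Rightarrow> ('g \<Rightarrow> 'x \<Rightarrow> 'x) \<Rightarrow> ('x \<Rightarrow> 'y) \<Rightarrow>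
   ('x \<Rightarrow> 'x \<Rightarrow> real) \<Rightarrow> ('y \<Rightarrow> 'y \<Rightarrow> real) \<Rightarrow> ereal" where
  "cond_metric_mdim \<Gamma> d \<sigma> X \<alpha> \<pi> \<rho>X \<rho>Y =
     Liminf (at_right 0)
       (\<lambda>\<epsilon>. cond_entropy_eps \<Gamma> d \<sigma> X \<alpha> \<pi> \<rho>X \<rho>Y \<epsilon> / ereal (ln (1 / \<epsilon>)))"

end

theory Submission
  imports Defs
begin

text \<open>Fix \<open>\<epsilon>\<close> and finitely many points \<open>a\<close> of \<open>X\<close> that are dense enough for \<open>\<rho>X\<close>. The functions
  \<open>\<phi> \<mapsto> \<rho>X (\<phi> v) a\<close>, cut off around thresholds \<open>\<xi> (v, a)\<close> to values in \<open>[0, 1]\<close>, map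
  \<open>K = Map \<inter> fibre\<close> into a cube. All points of a fibre have the same image in \<open>Y\<close>, so a maximal
  \<open>\<epsilon>'\<close>-separated set \<open>E\<close> in \<open>K\<close> has at most \<open>(1 / \<epsilon>')\<^bsup>D n\<^esup>\<close> elements. With about \<open>1 / \<epsilon>'\<close> disjoint
  transition windows to choose from for each coordinate, a random choice of the thresholds puts every
  point of \<open>E\<close>, hence of \<open>K\<close>, inside at most \<open>m \<approx> D n\<close> of its windows. The image of \<open>K\<close> thus
  lies in the \<open>m\<close>-skeleton of the cube, which has covering dimension at most \<open>m\<close>.

  As \<open>\<rho>X\<close> is only dynamically generating, equality of these coordinates controls \<open>\<rho> (\<phi> v) (\<phi>' v)\<close>
  only where \<open>\<phi>\<close> is nearly equivariant. The other \<open>v\<close>, a small proportion of \<open>{1..n}\<close>,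
  get further coordinates, which vanish where \<open>\<phi>\<close> is nearly equivariant. Allowing such pseudometrics
  reduces the second claim to the first inequality.\<close>

section \<open>Skeletons of cubes\<close>

text \<open>Coordinates from \<open>N\<close> on vanish, so that all cubes live in the type
  \<open>nat \<Rightarrow> real\<close> of the target spaces in \<open>Wdim\<close>. Coordinates
  outside \<open>{0, 1}\<close> are called fractional below.\<close>

definition cube_skeleton :: "nat \<Rightarrow> nat \<Rightarrow> (nat \<Rightarrow> real) set" where
  "cube_skeleton N m = {x. (\<forall>c. x c \<in> (if c < N then {0..1} else {0})) \<and>
     card {c. c < N \<and> x c \<notin> {0, 1}} \<le> m}"

text \<open>Once the set \<open>T\<close> of at most \<open>m\<close> free coordinates is fixed,
  what remains is a product of intervals and finite sets, compact by Tychonoff. There are finitely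
  many \<open>T\<close>.\<close>

lemma compact_cube_skeleton: "compact (cube_skeleton N m)"
proof -
  let ?K = "\<lambda>T c. if c \<in> T then {0..1} else if c < N then {0, 1} else {0::real}"
  have "cube_skeleton N m = (\<Union>T\<in>{T. T \<subseteq> {..<N} \<and> card T \<le> m}. PiE UNIV (?K T))" (is "?L = ?R")
  proof
    show "?L \<subseteq> ?R"
    proof
      fix x assume x: "x \<in> ?L"
      let ?T = "{c. c < N \<and> x c \<notin> {0, 1}}"
      have "x \<in> PiE UNIV (?K ?T)"
        using x unfolding cube_skeleton_def by (auto simp: PiE_def split: if_splits)
      moreover have "?T \<in> {T. T \<subseteq> {..<N} \<and> card T \<le> m}"
        using x by (auto simp: cube_skeleton_def)
      ultimately show "x \<in> ?R" by blast
    qed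
    show "?R \<subseteq> ?L"
    proof
      fix x assume "x \<in> ?R"
      then obtain T where T: "T \<subseteq> {..<N}" "card T \<le> m" and x: "\<And>c. x c \<in> ?K T c"
        by (auto simp: PiE_def Pi_def)
      have "{c. c < N \<and> x c \<notin> {0, 1}} \<subseteq> T"
      proof
        fix c assume "c \<in> {c. c < N \<and> x c \<notin> {0, 1}}"
        then show "c \<in> T" using x[of c] by (auto split: if_splits)
      qed
      then have "card {c. c < N \<and> x c \<notin> {0, 1}} \<le> m"
        using T by (meson card_mono finite_lessThan finite_subset order_trans)
      moreover have "x c \<in> (if c < N then {0..1} else {0})" for c
        using x[of c] T by (auto split: if_splits)
      ultimately show "x \<in> ?L" by (simp add: cube_skeleton_def)
    qed
  qed
  moreover have "compact (PiE UNIV (?K T))" for T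
  proof -
    have "compactin (product_topology (\<lambda>c. euclideanreal) UNIV) (PiE UNIV (?K T))"
      by (subst compactin_PiE) (auto simp: finite_imp_compact)
    then show ?thesis by (simp add: euclidean_product_topology)
  qed
  moreover have "finite {T. T \<subseteq> {..<N} \<and> card T \<le> m}"
    by (rule finite_subset[of _ "Pow {..<N}"]) auto
  ultimately show ?thesis by (simp add: compact_UN)
qed

text \<open>The weights \<open>(1/2)^n\<close> in the metric of the product add up to 2. This turns
  the mesh of a grid into a bound on diameters.\<close>

lemma dist_fun_le:
  fixes x y :: "nat \<Rightarrow> real"
  assumes "\<And>c. dist (x c) (y c) \<le> e"
  shows "dist x y \<le> 2 * e"
proof -
  have s: "(\<lambda>n. (1/2)^n * e) sums (2 * e)"
    using sums_mult2[OF geometric_sums[of "1/2::real"], of e] by simp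
  have "dist x y = (\<Sum>n. (1/2)^n * min (dist (x (from_nat n)) (y (from_nat n))) 1)"
    by (rule dist_fun_def)
  also have "\<dots> \<le> (\<Sum>n. (1/2)^n * e)"
  proof (rule suminf_le)
    show "summable (\<lambda>n. (1 / 2) ^ n * min (dist (x (from_nat n)) (y (from_nat n))) 1)"
      by (rule summable_comparison_test'[OF summable_geometric[of "1/2::real"], of 0]) auto
  qed (use s assms in \<open>auto intro!: mult_left_mono min.coboundedI1 sums_summable[OF s]\<close>)
  finally show ?thesis using sums_unique[OF s] by simp
qed

text \<open>A neighbourhood of the middle part of a \<open>card S\<close>-dimensional cell of the grid of mesh \<open>1 / q\<close>.
  For fixed \<open>r\<close>, those of the same dimension are disjoint; letting \<open>r\<close> decrease with the dimension
  makes them a cover, whose order is then at most the dimension of the skeleton plus 1.\<close>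

definition grid_cell ::
  "nat \<Rightarrow> nat \<Rightarrow> nat \<Rightarrow> real \<Rightarrow> nat set \<Rightarrow> (nat \<Rightarrow> int) \<Rightarrow> (nat \<Rightarrow> real) set" where
  "grid_cell N m q r S a = {x \<in> cube_skeleton N m. \<forall>c<N.
     if c \<in> S then of_int (a c) + r < q * x c \<and> q * x c < of_int (a c) + 1 - r
     else \<bar>q * x c - of_int (a c)\<bar> < r}"

lemma openin_grid_cell: "openin (top_of_set (cube_skeleton N m)) (grid_cell N m q r S a)"
proof -
  let ?U = "\<lambda>c. if c \<in> S
     then {x::nat \<Rightarrow> real. of_int (a c) + r < q * x c} \<inter> {x::nat \<Rightarrow> real. q * x c < of_int (a c) + 1 - r}
     else {x::nat \<Rightarrow> real. \<bar>q * x c - of_int (a c)\<bar> < r}"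
  have co: "continuous_on UNIV (\<lambda>x::nat \<Rightarrow> real. x c)" for c
    by (simp add: continuous_on_product_coordinates)
  have "open (?U c)" for c
    by (auto intro!: open_Int open_Collect_less continuous_intros co)
  then have "open (\<Inter>c<N. ?U c)" by (intro open_INT) auto
  moreover have "grid_cell N m q r S a = cube_skeleton N m \<inter> (\<Inter>c<N. ?U c)"
    unfolding grid_cell_def by (auto split: if_splits)
  ultimately show ?thesis by (auto simp: openin_open)
qed

text \<open>The point determines its cell: \<open>S\<close> consists of the \<open>c < N\<close> for
  which \<open>q * x c\<close> is farther than \<open>r\<close> from all integers, and
  \<open>a\<close> is the floor on \<open>S\<close> and the nearest integer off
  \<open>S\<close>.\<close>

lemma grid_cell_unique:
  assumes S: "S \<subseteq> {..<N}" "S' \<subseteq> {..<N}" "card S = card S'"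
    and a: "a \<in> extensional {..<N}" "a' \<in> extensional {..<N}"
    and r: "0 < r" "r < 1/2" and x: "x \<in> grid_cell N m q r S a" "x \<in> grid_cell N m q r S' a'"
  shows "S = S' \<and> a = a'"
proof -
  have sub: "T \<subseteq> T'"
    if "T \<subseteq> {..<N}" "x \<in> grid_cell N m q r T b" "x \<in> grid_cell N m q r T' b'" for T T' b b'
  proof
    fix c assume "c \<in> T"
    show "c \<in> T'"
    proof (rule ccontr)
      assume "c \<notin> T'"
      then have "of_int (b c) + r < q * x c" "q * x c < of_int (b c) + 1 - r" "\<bar>q * x c - b' c\<bar> < r"
        using that \<open>c \<in> T\<close> unfolding grid_cell_def by (auto dest!: spec[of _ c])
      \<comment> \<open>\<open>b' c\<close> would be an integer strictly between two consecutive
        ones.\<close>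
      then have "b c < b' c" "b' c < b c + 1" by linarith+
      then show False by linarith
    qed
  qed
  have SS: "S = S'" using sub[OF S(1) x] sub[OF S(2) x(2) x(1)] by blast
  have "a c = a' c" if "c < N" for c
  proof -
    have "a c < a' c + 1" "a' c < a c + 1"
      using that x SS r unfolding grid_cell_def by (auto dest!: spec[of _ c] split: if_splits)
    then show ?thesis by linarith
  qed
  then show ?thesis using SS a by (auto intro: extensionalityI)
qed

text \<open>A pigeonhole over the radii. As \<open>r j\<close> decreases, the set \<open>S j\<close>
  of coordinates at distance at least \<open>r j\<close> from the grid grows. At the first
  \<open>j\<close> with at most \<open>j\<close> such coordinates, nothing was added since
  \<open>j - 1\<close>; so there are exactly \<open>j\<close> of them, and none is at distance
  exactly \<open>r j\<close>.\<close>

lemma grid_cell_cover: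
  assumes x: "x \<in> cube_skeleton N m" and q: "q > 0"
  shows "\<exists>j\<le>m. \<exists>S a. S \<subseteq> {..<N} \<and> card S = j \<and> a \<in> {..<N} \<rightarrow>\<^sub>E {0..int q} \<and>
           x \<in> grid_cell N m q (1 / (real j + 3)) S a"
proof -
  define r where "r = (\<lambda>j. 1 / (real j + 3))"
  define t where "t = (\<lambda>c. \<bar>q * x c - round (q * x c)\<bar>)"
  define S where "S = (\<lambda>j. {c. c < N \<and> r j \<le> t c})"
  have fS: "finite (S j)" for j unfolding S_def by simp
  have rpos: "r j > 0" for j unfolding r_def by simp
  have t0: "t c = 0" if "x c = 0 \<or> x c = 1" for c
    using that unfolding t_def by auto
  \<comment> \<open>Coordinates 0 and 1 lie on the grid, so the skeleton condition makes
    \<open>m\<close> a candidate for the \<open>LEAST\<close> below.\<close>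
  have "S m \<subseteq> {c. c < N \<and> x c \<notin> {0, 1}}"
    using t0 rpos[of m] unfolding S_def by auto
  then have "card (S m) \<le> card {c. c < N \<and> x c \<notin> {0, 1}}" by (intro card_mono) auto
  then have Sm: "card (S m) \<le> m" using x unfolding cube_skeleton_def by simp
  define j where "j = (LEAST j. card (S j) \<le> j)"
  have j: "card (S j) \<le> j" "j \<le> m"
    unfolding j_def by (rule LeastI[of _ m], rule Sm) (rule Least_le, rule Sm)
  have "card (S j) = j \<and> (\<forall>c\<in>S j. r j < t c)"
  proof (cases j)
    case 0
    then show ?thesis using j fS[of 0] by simp
  next
    case (Suc i)
    \<comment> \<open>By minimality \<open>S i\<close> already has \<open>i + 1 = j\<close>
      elements, so it fills \<open>S j\<close>. Distance at least \<open>r i\<close> is more than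
      \<open>r j\<close>, which gives the strict inequality.\<close>
    have "\<not> card (S i) \<le> i" using not_less_Least[of i "\<lambda>j. card (S j) \<le> j"] Suc j_def by simp
    have ri: "r j < r i" unfolding r_def Suc by (simp add: field_simps)
    then have "S i \<subseteq> S j" unfolding S_def by auto
    moreover from this have "card (S i) \<le> card (S j)" using fS card_mono by blast
    ultimately have "S i = S j" "card (S j) = j"
      using \<open>\<not> card (S i) \<le> i\<close> j Suc fS card_seteq[of "S j" "S i"] by auto
    moreover have "r j < t c" if "c \<in> S i" for c using that ri unfolding S_def by simp
    ultimately show ?thesis by simp
  qed
  then have cj: "card (S j) = j" and tj: "\<And>c. c \<in> S j \<Longrightarrow> r j < t c" by auto
  define a where "a = (\<lambda>c\<in>{..<N}. if c \<in> S j then \<lfloor>q * x c\<rfloor> else round (q * x c))"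
  have x01: "0 \<le> x c \<and> x c \<le> 1" if "c < N" for c
    using x that unfolding cube_skeleton_def by (auto split: if_splits)
  have qx: "0 \<le> q * x c \<and> q * x c \<le> q" if "c < N" for c
    using x01[OF that] q by (simp add: mult_left_le)
  have "a \<in> {..<N} \<rightarrow>\<^sub>E {0..int q}"
  proof -
    have "\<lfloor>q * x c\<rfloor> \<in> {0..int q} \<and> round (q * x c) \<in> {0..int q}" if "c < N" for c
      using qx[OF that] round_mono[of 0 "q * x c"] round_mono[of "q * x c" "real q"]
      by (auto simp: le_floor_iff floor_le_iff)
    then show ?thesis unfolding a_def by auto
  qed
  moreover have "x \<in> grid_cell N m q (r j) (S j) a"
    unfolding grid_cell_def
  proof (intro CollectI conjI x allI impI)
    fix c assume c: "c < N"
    show "if c \<in> S j then of_int (a c) + r j < q * x c \<and> q * x c < of_int (a c) + 1 - r j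
          else \<bar>q * x c - of_int (a c)\<bar> < r j"
    proof (cases "c \<in> S j")
      case True
      then have "r j < t c" by (rule tj)
      \<comment> \<open>\<open>t c\<close> is the distance to the nearest integer, so both ends of
        the unit interval around \<open>q * x c\<close> are farther than \<open>r j\<close>
        away.\<close>
      moreover have "t c \<le> \<bar>q * x c - real_of_int k\<bar>" for k
        unfolding t_def by (rule round_diff_minimal)
      ultimately have gap: "r j < \<bar>q * x c - real_of_int k\<bar>" for k by (rule less_le_trans)
      have "a c = \<lfloor>q * x c\<rfloor>" using c True unfolding a_def by simp
      then have "of_int (a c) \<le> q * x c" "q * x c < of_int (a c) + 1" by linarith+
      then have "of_int (a c) + r j < q * x c" "q * x c < of_int (a c) + 1 - r j"
        using gap[of "a c"] gap[of "a c + 1"] by auto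
      then show ?thesis using True by auto
    next
      case False
      then show ?thesis using c unfolding S_def a_def t_def by auto
    qed
  qed
  moreover have "S j \<subseteq> {..<N}" unfolding S_def by auto
  ultimately show ?thesis using j(2) cj unfolding r_def by blast
qed

text \<open>The cells of a grid that is fine against a Lebesgue number of the cover refine it. At
  most one cell of each dimension \<open>0, ..., m\<close> contains a given point, hence at most
  \<open>m + 1\<close> cells do.\<close>

lemma covering_dim_cube_skeleton:
  "covering_dim (top_of_set (cube_skeleton N m)) \<le> ereal (real m)"
proof -
  let ?P = "top_of_set (cube_skeleton N m)"
  have "\<exists>\<V>. finite \<V> \<and> (\<forall>V\<in>\<V>. openin ?P V) \<and> \<Union>\<V> = topspace ?P \<and>
             (\<forall>V\<in>\<V>. \<exists>U\<in>\<U>. V \<subseteq> U) \<and>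
             (\<forall>x\<in>topspace ?P. int (card {V\<in>\<V>. x \<in> V}) \<le> int m + 1)"
    if \<U>: "\<forall>U\<in>\<U>. openin ?P U" "\<Union>\<U> = topspace ?P" for \<U>
  proof -
    let ?\<T> = "{T. open T \<and> cube_skeleton N m \<inter> T \<in> \<U>}"
    \<comment> \<open>The origin ensures that the open cover given to
      \<open>Lebesgue_number_lemma\<close> is a nonempty family.\<close>
    have zero: "(\<lambda>c. 0) \<in> cube_skeleton N m" by (auto simp: cube_skeleton_def)
    have cov: "cube_skeleton N m \<subseteq> \<Union>?\<T>"
    proof
      fix x assume x: "x \<in> cube_skeleton N m"
      then obtain U where "U \<in> \<U>" "x \<in> U" using \<U> by auto
      moreover from this obtain T where "open T" "U = cube_skeleton N m \<inter> T"
        using \<U> by (auto simp: openin_open)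
      ultimately show "x \<in> \<Union>?\<T>" by auto
    qed
    then have "?\<T> \<noteq> {}" using zero by blast
    then obtain \<delta> where "0 < \<delta>" and
      \<delta>: "\<And>T. \<lbrakk>T \<subseteq> cube_skeleton N m; diameter T < \<delta>\<rbrakk> \<Longrightarrow> \<exists>B\<in>?\<T>. T \<subseteq> B"
      using Lebesgue_number_lemma[OF compact_cube_skeleton _ cov] by blast
    \<comment> \<open>Cells have extent at most \<open>1 / q\<close> in each coordinate, hence
      diameter at most \<open>2 / q\<close> by \<open>dist_fun_le\<close>, which has to stay below
      the Lebesgue number.\<close>
    obtain q :: nat where q: "2 / \<delta> < q" using reals_Archimedean2 by blast
    then have q0: "q > 0" using \<open>0 < \<delta>\<close> by (metis divide_pos_pos less_trans of_nat_0_less_iff zero_less_numeral)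
    have q\<delta>: "2 / q < \<delta>" using q q0 \<open>0 < \<delta>\<close> by (simp add: field_simps)
    let ?r = "\<lambda>j. 1 / (real j + 3)"
    define \<W> where "\<W> j = (\<lambda>(S, a). grid_cell N m q (?r j) S a) `
       ({S. S \<subseteq> {..<N} \<and> card S = j} \<times> ({..<N} \<rightarrow>\<^sub>E {0..int q}))" for j
    define \<V> where "\<V> = (\<Union>j\<le>m. \<W> j)"
    have fin: "finite (\<W> j)" for j unfolding \<W>_def
      by (intro finite_imageI finite_cartesian_product finite_PiE) auto
    have sub: "V \<subseteq> cube_skeleton N m" if "V \<in> \<V>" for V
      using that unfolding \<V>_def \<W>_def grid_cell_def by auto
    show ?thesis
    proof (intro exI[of _ \<V>] conjI ballI)
      show "finite \<V>" using fin unfolding \<V>_def by auto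
      show "openin ?P V" if "V \<in> \<V>" for V
        using that openin_grid_cell unfolding \<V>_def \<W>_def by auto
      show "\<Union>\<V> = topspace ?P"
      proof
        show "\<Union>\<V> \<subseteq> topspace ?P" using sub by auto
        show "topspace ?P \<subseteq> \<Union>\<V>"
        proof
          fix x assume "x \<in> topspace ?P"
          then have x: "x \<in> cube_skeleton N m" by simp
          obtain j S a where "j \<le> m" "S \<subseteq> {..<N}" "card S = j"
            "a \<in> {..<N} \<rightarrow>\<^sub>E {0..int q}" and xc: "x \<in> grid_cell N m q (?r j) S a"
            using grid_cell_cover[OF x q0] by blast
          then have "grid_cell N m q (?r j) S a \<in> \<W> j" unfolding \<W>_def
            by (intro image_eqI[of _ _ "(S, a)"]) auto
          then show "x \<in> \<Union>\<V>" using \<open>j \<le> m\<close> xc unfolding \<V>_def by blast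
        qed
      qed
      show "\<exists>U\<in>\<U>. V \<subseteq> U" if V: "V \<in> \<V>" for V
      proof -
        have "dist x y \<le> 2 / q" if xy: "x \<in> V" "y \<in> V" for x y
        proof -
          obtain j S a where Va: "V = grid_cell N m q (?r j) S a"
            using V unfolding \<V>_def \<W>_def by auto
          have "dist (x c) (y c) \<le> 1 / q" for c
          proof (cases "c < N")
            case True
            have r: "0 < ?r j" "?r j < 1/2" by (auto simp: field_simps)
            have *: "\<forall>c<N. if c \<in> S then of_int (a c) + ?r j < q * z c \<and> q * z c < of_int (a c) + 1 - ?r j
              else \<bar>q * z c - of_int (a c)\<bar> < ?r j" if "z \<in> V" for z :: "nat \<Rightarrow> real"
              using that unfolding Va grid_cell_def by simp
            \<comment> \<open>After scaling by \<open>q\<close>, a coordinate in \<open>S\<close>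
              ranges within a unit interval, any other one within an interval of length
              \<open>2 * ?r j < 1\<close>.\<close>
            have "\<bar>q * x c - q * y c\<bar> \<le> 1"
            proof (cases "c \<in> S")
              case inS: True
              then have "of_int (a c) + ?r j < q * z c \<and> q * z c < of_int (a c) + 1 - ?r j"
                if "z \<in> V" for z :: "nat \<Rightarrow> real" using *[OF that] True by auto
              from this[OF xy(1)] this[OF xy(2)] show ?thesis using r(1) by arith
            next
              case False
              then have "\<bar>q * z c - of_int (a c)\<bar> < ?r j" if "z \<in> V" for z :: "nat \<Rightarrow> real"
                using *[OF that] True by auto
              from this[OF xy(1)] this[OF xy(2)] show ?thesis using r(2) by arith
            qed
            then have "q * \<bar>x c - y c\<bar> \<le> 1" by (simp add: abs_mult right_diff_distrib[symmetric])
            then show ?thesis using q0 by (simp add: dist_real_def field_simps)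
          next
            case False
            then have "x c = 0" "y c = 0"
              using xy sub[OF V] unfolding cube_skeleton_def by (auto split: if_splits)
            then show ?thesis by simp
          qed
          from dist_fun_le[OF this] show ?thesis by simp
        qed
        then have "diameter V \<le> 2 / q"
          using q0 by (auto simp: diameter_def intro!: cSUP_least)
        then have "diameter V < \<delta>" using q\<delta> by linarith
        then obtain B where "B \<in> ?\<T>" "V \<subseteq> B" using \<delta>[OF sub[OF V]] by blast
        then show ?thesis using sub[OF V] by blast
      qed
      show "int (card {V\<in>\<V>. x \<in> V}) \<le> int m + 1" for x
      proof -
        have one: "card {V\<in>\<W> j. x \<in> V} \<le> 1" for j
        proof -
          have "V = V'" if "V \<in> \<W> j" "V' \<in> \<W> j" "x \<in> V" "x \<in> V'" for V V'
          proof -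
            from that(1) obtain S a where "S \<subseteq> {..<N}" "card S = j"
              "a \<in> {..<N} \<rightarrow>\<^sub>E {0..int q}" "V = grid_cell N m q (?r j) S a"
              unfolding \<W>_def by auto
            moreover from that(2) obtain S' a' where "S' \<subseteq> {..<N}" "card S' = j"
              "a' \<in> {..<N} \<rightarrow>\<^sub>E {0..int q}" "V' = grid_cell N m q (?r j) S' a'"
              unfolding \<W>_def by auto
            ultimately show ?thesis
              using grid_cell_unique[of S N S' a a' "?r j" x m q] that by (simp add: PiE_def field_simps)
          qed
          then show ?thesis
            using fin[of j] by (auto simp: card_le_Suc0_iff_eq)
        qed
        have "{V\<in>\<V>. x \<in> V} = (\<Union>j\<le>m. {V\<in>\<W> j. x \<in> V})" unfolding \<V>_def by auto
        then have "card {V\<in>\<V>. x \<in> V} \<le> (\<Sum>j\<le>m. card {V\<in>\<W> j. x \<in> V})"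
          by (simp add: card_UN_le)
        also have "\<dots> \<le> (\<Sum>j\<le>m. 1)" using one by (intro sum_mono) auto
        finally show ?thesis by simp
      qed
    qed
  qed
  then show ?thesis
    unfolding covering_dim_def
    by (intro Inf_lower CollectI exI[of _ "int m"] conjI allI impI) auto
qed

section \<open>Width dimension from coordinate functions, and the random choice of
  thresholds\<close>

text \<open>Listing the coordinates gives a continuous map to a cube, and the bound on the
  fractional ones puts its image into the \<open>m\<close>-skeleton. It remains to construct such
  coordinates for fibres of maps.\<close>

lemma Wdim_le_coordinates:
  fixes g :: "'c \<Rightarrow> 'k \<Rightarrow> real"
  assumes C: "finite C"
    and cont: "\<And>c. c \<in> C \<Longrightarrow> continuous_map K euclideanreal (g c)"
    and g01: "\<And>c \<phi>. c \<in> C \<Longrightarrow> \<phi> \<in> topspace K \<Longrightarrow> g c \<phi> \<in> {0..1}"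
    and few: "\<And>\<phi>. \<phi> \<in> topspace K \<Longrightarrow> card {c \<in> C. g c \<phi> \<notin> {0, 1}} \<le> m"
    and sep: "\<And>\<phi> \<phi>'. \<phi> \<in> topspace K \<Longrightarrow> \<phi>' \<in> topspace K \<Longrightarrow>
      (\<And>c. c \<in> C \<Longrightarrow> g c \<phi> = g c \<phi>') \<Longrightarrow> \<rho> \<phi> \<phi>' < \<epsilon>"
  shows "Wdim \<epsilon> K \<rho> \<le> ereal (real m)"
proof -
  obtain e where e: "bij_betw e {..<card C} C"
    using ex_bij_betw_nat_finite[OF C] by (auto simp: atLeast0LessThan)
  define f where "f \<phi> = (\<lambda>i. if i < card C then g (e i) \<phi> else 0)" for \<phi>
  let ?P = "top_of_set (cube_skeleton (card C) m)"
  have eC: "e i \<in> C" if "i < card C" for i using e that by (auto simp: bij_betw_def)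
  have "f \<phi> \<in> cube_skeleton (card C) m" if \<phi>: "\<phi> \<in> topspace K" for \<phi>
  proof -
    have "inj_on e {i. i < card C \<and> f \<phi> i \<notin> {0, 1}}"
      using e by (rule inj_on_subset[OF bij_betw_imp_inj_on]) auto
    moreover have "e ` {i. i < card C \<and> f \<phi> i \<notin> {0, 1}} \<subseteq> {c \<in> C. g c \<phi> \<notin> {0, 1}}"
      using eC by (auto simp: f_def)
    moreover have "finite {c \<in> C. g c \<phi> \<notin> {0, 1}}" using C by simp
    ultimately have "card {i. i < card C \<and> f \<phi> i \<notin> {0, 1}} \<le> card {c \<in> C. g c \<phi> \<notin> {0, 1}}"
      by (rule card_inj_on_le)
    then show ?thesis
      using few[OF \<phi>] g01[OF eC \<phi>] by (auto simp: cube_skeleton_def f_def)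
  qed
  moreover have "continuous_map K euclidean f"
    unfolding euclidean_product_topology[symmetric] continuous_map_componentwise_UNIV
    using cont eC by (simp add: f_def)
  ultimately have "continuous_map K ?P f"
    by (auto simp: continuous_map_in_subtopology)
  moreover have "\<rho> \<phi> \<phi>' < \<epsilon>" if "\<phi> \<in> topspace K" "\<phi>' \<in> topspace K" "f \<phi> = f \<phi>'" for \<phi> \<phi>'
  proof (rule sep[OF that(1,2)])
    fix c assume "c \<in> C"
    then obtain i where "i < card C" "c = e i" using e by (auto simp: bij_betw_def)
    then show "g c \<phi> = g c \<phi>'" using fun_cong[OF that(3), of i] by (simp add: f_def)
  qed
  moreover have "compact_space ?P"
    using compact_cube_skeleton by (simp add: compact_space_subtopology)
  moreover have "metrizable_space ?P"
    by (simp add: metrizable_space_euclidean metrizable_space_subtopology)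
  ultimately have "Wdim \<epsilon> K \<rho> \<le> covering_dim ?P"
    unfolding Wdim_def by (intro Inf_lower) blast
  also have "\<dots> \<le> ereal (real m)" by (rule covering_dim_cube_skeleton)
  finally show ?thesis .
qed

text \<open>A uniformly random \<open>\<xi>\<close> fails with probability at most \<open>card E * 2 ^ card C / L ^ (m + 1)\<close>, by a
  union bound over \<open>e\<close> and the sets of \<open>m + 1\<close> coordinates.\<close>

lemma exists_choice_few_excluded:
  fixes B :: "'e \<Rightarrow> 'c \<Rightarrow> nat \<Rightarrow> bool"
  assumes C: "finite C" and E: "finite E"
    and one: "\<And>e c l l'. \<lbrakk>e \<in> E; c \<in> C; l < L; l' < L; B e c l; B e c l'\<rbrakk> \<Longrightarrow> l = l'"
    and lt: "card E * 2 ^ card C < L ^ (m + 1)"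
  shows "\<exists>\<xi>. (\<forall>c\<in>C. \<xi> c < L) \<and> (\<forall>e\<in>E. card {c \<in> C. B e c (\<xi> c)} \<le> m)"
proof (rule ccontr)
  assume no: "\<not> ?thesis"
  let ?S = "{S. S \<subseteq> C \<and> card S = m + 1}"
  \<comment> \<open>\<open>Bad e S\<close> collects the choices that are bad for \<open>e\<close> at
    every coordinate in \<open>S\<close>; each failing choice lies in one of these sets.\<close>
  define Bad where "Bad e S = PiE C (\<lambda>c. if c \<in> S then {l. l < L \<and> B e c l} else {..<L})" for e S
  have L: "L > 0" using lt by (cases L) auto
  have finS: "finite ?S" "card ?S \<le> 2 ^ card C"
    using C card_mono[of "Pow C" ?S] by (auto simp: card_Pow)
  \<comment> \<open>Each coordinate in \<open>S\<close> leaves at most one of the \<open>L\<close>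
    values, so \<open>Bad e S\<close> is at most a fraction \<open>1 / L ^ (m + 1)\<close> of all
    choices.\<close>
  have cardBad: "card (Bad e S) * L ^ (m + 1) \<le> L ^ card C" if e: "e \<in> E" and S: "S \<in> ?S" for e S
  proof -
    have SC: "S \<subseteq> C" "card S = m + 1" "finite S" using S C finite_subset by auto
    have "card (Bad e S) = (\<Prod>c\<in>C. card (if c \<in> S then {l. l < L \<and> B e c l} else {..<L}))"
      unfolding Bad_def by (rule card_PiE[OF C])
    also have "\<dots> \<le> (\<Prod>c\<in>C. if c \<in> S then 1 else L)"
    proof (rule prod_mono)
      fix c assume c: "c \<in> C"
      have "card {l. l < L \<and> B e c l} \<le> Suc 0"
        using one[OF e c] by (subst card_le_Suc0_iff_eq) auto
      then show "0 \<le> card (if c \<in> S then {l. l < L \<and> B e c l} else {..<L}) \<and>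
        card (if c \<in> S then {l. l < L \<and> B e c l} else {..<L}) \<le> (if c \<in> S then 1 else L)"
        by auto
    qed
    also have "\<dots> = L ^ card (C - S)"
      using C by (simp add: prod.If_cases Diff_eq)
    finally have "card (Bad e S) * L ^ (m + 1) \<le> L ^ card (C - S) * L ^ card S"
      using SC by simp
    moreover have "card (C - S) + card S = card C"
      using SC C by (metis card_Diff_subset card_mono le_add_diff_inverse2)
    then have "L ^ card (C - S) * L ^ card S = L ^ card C"
      by (metis power_add)
    ultimately show ?thesis by simp
  qed
  have cover: "PiE C (\<lambda>_. {..<L}) \<subseteq> (\<Union>(e, S)\<in>E \<times> ?S. Bad e S)"
  proof
    fix \<xi> assume \<xi>: "\<xi> \<in> PiE C (\<lambda>_. {..<L})"
    then have "\<forall>c\<in>C. \<xi> c < L" by auto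
    then obtain e where e: "e \<in> E" "\<not> card {c \<in> C. B e c (\<xi> c)} \<le> m"
      using no by blast
    then have "m + 1 \<le> card {c \<in> C. B e c (\<xi> c)}" by simp
    then obtain S where S: "S \<subseteq> {c \<in> C. B e c (\<xi> c)}" "card S = m + 1"
      by (rule obtain_subset_with_card_n)
    then have "S \<in> ?S" by auto
    moreover have "\<xi> \<in> Bad e S"
      using \<xi> S(1) unfolding Bad_def PiE_iff by (auto simp: subset_iff)
    ultimately show "\<xi> \<in> (\<Union>(e, S)\<in>E \<times> ?S. Bad e S)" using e by blast
  qed
  have finBad: "finite (Bad e S)" for e S unfolding Bad_def using C by (intro finite_PiE) auto
  have "L ^ card C * L ^ (m + 1) = card (PiE C (\<lambda>_. {..<L})) * L ^ (m + 1)"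
    using C by (simp add: card_PiE)
  also have "\<dots> \<le> card (\<Union>(e, S)\<in>E \<times> ?S. Bad e S) * L ^ (m + 1)"
    using E finS finBad by (intro mult_right_mono card_mono[OF _ cover]) auto
  also have "\<dots> \<le> (\<Sum>p\<in>E \<times> ?S. card (case p of (e, S) \<Rightarrow> Bad e S)) * L ^ (m + 1)"
    using E finS by (intro mult_right_mono card_UN_le) auto
  also have "\<dots> \<le> (\<Sum>p\<in>E \<times> ?S. L ^ card C)"
    unfolding sum_distrib_right by (intro sum_mono) (use cardBad in auto)
  also have "\<dots> = card E * card ?S * L ^ card C"
    by (simp add: card_cartesian_product)
  also have "\<dots> \<le> (card E * 2 ^ card C) * L ^ card C"
    using finS(2) by (intro mult_right_mono mult_left_mono) auto
  also have "\<dots> < L ^ (m + 1) * L ^ card C"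
    using lt L by (intro mult_strict_right_mono) auto
  finally show False by (simp add: mult.commute)
qed

section \<open>Pseudometrics on compact spaces\<close>

lemma continuous_map_pseudometric:
  assumes "continuous_pseudometric X \<rho>" "continuous_map Z X f" "continuous_map Z X g"
  shows "continuous_map Z euclideanreal (\<lambda>z. \<rho> (f z) (g z))"
proof -
  have "continuous_map Z euclideanreal ((\<lambda>(x, y). \<rho> x y) \<circ> (\<lambda>z. (f z, g z)))"
    using assms by (intro continuous_map_compose[of _ "prod_topology X X"])
      (auto simp: continuous_pseudometric_def continuous_map_paired)
  then show ?thesis by (simp add: o_def)
qed

lemma continuous_pseudometric_self:
  "continuous_pseudometric X \<rho> \<Longrightarrow> x \<in> topspace X \<Longrightarrow> \<rho> x x = 0"
  unfolding continuous_pseudometric_def by auto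

lemma continuous_pseudometricD:
  assumes "continuous_pseudometric X \<rho>" "x \<in> topspace X" "y \<in> topspace X"
  shows "0 \<le> \<rho> x y" "\<rho> x y = \<rho> y x" "z \<in> topspace X \<Longrightarrow> \<rho> x z \<le> \<rho> x y + \<rho> y z"
  using assms unfolding continuous_pseudometric_def by auto

lemma compatible_metric_imp_continuous_pseudometric:
  assumes "compatible_metric X \<rho>"
  shows "continuous_pseudometric X \<rho>"
proof -
  interpret Metric_space "topspace X" \<rho> using assms by (simp add: compatible_metric_def)
  have X: "mtopology = X" using assms by (simp add: compatible_metric_def)
  have "continuous_map (prod_topology X X) euclideanreal (\<lambda>(x, y). \<rho> x y)"
    using continuous_map_metric[of Self] X by (simp add: mtopology_of_def)
  then show ?thesis
    unfolding continuous_pseudometric_def using commute triangle by auto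
qed

text \<open>The open sets \<open>w i > 1 / Suc k\<close> cover the compact set where
  \<open>u\<close> is at least \<open>\<epsilon>\<close>; a finite subcover yields the indices and a
  common threshold. Pointwise separation thus becomes uniform.\<close>

lemma compact_finite_witness:
  fixes u :: "'z \<Rightarrow> real" and w :: "'i \<Rightarrow> 'z \<Rightarrow> real"
  assumes Z: "compact_space Z" and u: "continuous_map Z euclideanreal u"
    and w: "\<And>i. i \<in> I \<Longrightarrow> continuous_map Z euclideanreal (w i)"
    and pos: "\<And>z. z \<in> topspace Z \<Longrightarrow> \<epsilon> \<le> u z \<Longrightarrow> \<exists>i\<in>I. 0 < w i z"
  shows "\<exists>F e. finite F \<and> F \<subseteq> I \<and> 0 < e \<and>
           (\<forall>z\<in>topspace Z. (\<forall>i\<in>F. w i z < e) \<longrightarrow> u z < \<epsilon>)"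
proof -
  define W where "W = {z \<in> topspace Z. u z \<in> {\<epsilon>..}}"
  define Op where "Op = (\<lambda>(i, k). {z \<in> topspace Z. w i z \<in> {1 / real (Suc k)<..}})"
  have "closedin Z W" unfolding W_def
    by (rule closedin_continuous_map_preimage[OF u]) auto
  then have "compactin Z W" using Z by (rule closedin_compact_space[rotated])
  moreover have "openin Z (Op p)" if p: "p \<in> I \<times> UNIV" for p
  proof -
    obtain i k where "p = (i, k)" "i \<in> I" using p by auto
    then show ?thesis unfolding Op_def
      using openin_continuous_map_preimage[OF w, of i "{1 / real (Suc k)<..}"] by auto
  qed
  moreover have "W \<subseteq> \<Union>(Op ` (I \<times> UNIV))"
  proof
    fix z assume "z \<in> W"
    then obtain i where "i \<in> I" "0 < w i z" "z \<in> topspace Z" using pos unfolding W_def by auto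
    moreover from this obtain k where "1 / real (Suc k) < w i z"
      by (metis nat_approx_posE)
    ultimately show "z \<in> \<Union>(Op ` (I \<times> UNIV))" unfolding Op_def by force
  qed
  ultimately obtain \<F> where "finite \<F>" "\<F> \<subseteq> Op ` (I \<times> UNIV)" "W \<subseteq> \<Union>\<F>"
    using compactinD[of Z W "Op ` (I \<times> UNIV)"] by blast
  then obtain Q where Q: "finite Q" "Q \<subseteq> I \<times> UNIV" and WQ: "W \<subseteq> \<Union>(Op ` Q)"
    using finite_subset_image[of \<F> Op "I \<times> UNIV"] by blast
  \<comment> \<open>The bound on the \<open>k\<close> in the subcover provides a threshold that
    works for all of its members.\<close>
  obtain N where N: "\<And>p. p \<in> Q \<Longrightarrow> snd p \<le> N"
    using Q(1) finite_nat_set_iff_bounded_le[of "snd ` Q"] by auto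
  show ?thesis
  proof (intro exI[of _ "fst ` Q"] exI[of _ "1 / real (Suc N)"] conjI ballI impI)
    fix z assume z: "z \<in> topspace Z" "\<forall>i\<in>fst ` Q. w i z < 1 / real (Suc N)"
    show "u z < \<epsilon>"
    proof (rule ccontr)
      assume "\<not> u z < \<epsilon>"
      then have "z \<in> W" using z unfolding W_def by auto
      then obtain p where p: "p \<in> Q" "z \<in> Op p" using WQ by auto
      then have "1 / real (Suc (snd p)) < w (fst p) z" unfolding Op_def by (auto simp: case_prod_beta)
      moreover have "1 / real (Suc N) \<le> 1 / real (Suc (snd p))"
        using N[OF p(1)] by (simp add: frac_le)
      ultimately show False using z(2) p(1) by force
    qed
  qed (use Q in auto)
qed

lemma pseudometric_finite_net:
  assumes X: "compact_space X" and \<rho>: "continuous_pseudometric X \<rho>" and r: "r > 0"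
  shows "\<exists>A. finite A \<and> A \<subseteq> topspace X \<and> (\<forall>x\<in>topspace X. \<exists>a\<in>A. \<rho> x a < r)"
proof -
  let ?Op = "\<lambda>a. {x \<in> topspace X. \<rho> x a \<in> {..<r}}"
  have "openin X (?Op a)" if "a \<in> topspace X" for a
  proof -
    have "continuous_map X euclideanreal (\<lambda>x. \<rho> x a)"
      using that by (intro continuous_map_pseudometric[OF \<rho>]) auto
    then show ?thesis by (rule openin_continuous_map_preimage) auto
  qed
  moreover have "topspace X \<subseteq> \<Union>(?Op ` topspace X)"
    using continuous_pseudometric_self[OF \<rho>] r by force
  ultimately obtain \<F> where "finite \<F>" "\<F> \<subseteq> ?Op ` topspace X" "topspace X \<subseteq> \<Union>\<F>"
    using compactinD[of X "topspace X" "?Op ` topspace X"] X unfolding compact_space_def by blast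
  then obtain A where A: "finite A" "A \<subseteq> topspace X" "topspace X \<subseteq> \<Union>(?Op ` A)"
    using finite_subset_image[of \<F> ?Op "topspace X"] by blast
  have "\<exists>a\<in>A. \<rho> x a < r" if "x \<in> topspace X" for x
    using A(3) that by fastforce
  then show ?thesis using A by blast
qed

lemma pseudometric_bounded:
  assumes X: "compact_space X" and \<rho>: "continuous_pseudometric X \<rho>"
  shows "\<exists>M>0. \<forall>x\<in>topspace X. \<forall>y\<in>topspace X. \<rho> x y \<le> M"
proof -
  let ?P = "prod_topology X X"
  have "compactin ?P (topspace ?P)"
    using X compact_space_prod_topology[of X X] unfolding compact_space_def by blast
  then have "compactin euclideanreal ((\<lambda>(x, y). \<rho> x y) ` topspace ?P)"
    using \<rho> by (intro image_compactin[of ?P]) (auto simp: continuous_pseudometric_def)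
  then have "bounded ((\<lambda>(x, y). \<rho> x y) ` topspace ?P)"
    by (simp add: compact_imp_bounded)
  then obtain M where "0 < M" "\<forall>z\<in>(\<lambda>(x, y). \<rho> x y) ` topspace ?P. norm z \<le> M"
    unfolding bounded_pos by blast
  then show ?thesis by (intro exI[of _ M]) force
qed

text \<open>An instance of \<open>compact_finite_witness\<close> with one function on the square of
  \<open>X\<close>: off the diagonal \<open>\<rho>\<close> is positive, and on it
  \<open>\<rho>X\<close> vanishes.\<close>

lemma pseudometric_uniformly_small:
  assumes X: "compact_space X" and \<rho>: "compatible_metric X \<rho>"
    and \<rho>X: "continuous_pseudometric X \<rho>X" and \<eta>: "\<eta> > 0"
  shows "\<exists>t>0. \<forall>x\<in>topspace X. \<forall>y\<in>topspace X. \<rho> x y < t \<longrightarrow> \<rho>X x y < \<eta>"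
proof -
  interpret Metric_space "topspace X" \<rho> using \<rho> by (simp add: compatible_metric_def)
  let ?P = "prod_topology X X"
  have c: "continuous_map ?P euclideanreal (\<lambda>z. \<rho>' (fst z) (snd z))"
    if "continuous_pseudometric X \<rho>'" for \<rho>'
    by (intro continuous_map_pseudometric[OF that] continuous_map_fst continuous_map_snd)
  have "compact_space ?P" using X compact_space_prod_topology by blast
  then have "\<exists>F e. finite F \<and> F \<subseteq> {()} \<and> 0 < e \<and> (\<forall>z\<in>topspace ?P.
      (\<forall>i\<in>F. \<rho> (fst z) (snd z) < e) \<longrightarrow> \<rho>X (fst z) (snd z) < \<eta>)"
  proof (rule compact_finite_witness[OF _ c[OF \<rho>X]])
    show "continuous_map ?P euclideanreal (\<lambda>z. \<rho> (fst z) (snd z))"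
      by (rule c[OF compatible_metric_imp_continuous_pseudometric[OF \<rho>]])
    fix z assume z: "z \<in> topspace ?P" "\<eta> \<le> \<rho>X (fst z) (snd z)"
    then have "fst z \<noteq> snd z"
      using \<eta> continuous_pseudometric_self[OF \<rho>X] by force
    then have "0 < \<rho> (fst z) (snd z)" using z by (auto simp: mdist_pos_less)
    then show "\<exists>i\<in>{()}. 0 < \<rho> (fst z) (snd z)" by simp
  qed
  then show ?thesis by fastforce
qed

text \<open>Compactness of the square of \<open>X\<close> replaces the supremum over the group by
  finitely many \<open>s\<close> and a uniform \<open>e\<close>.\<close>

lemma dynamically_generating_witness:
  assumes X: "compact_space X" and \<rho>: "compatible_metric X \<rho>"
    and \<rho>X: "continuous_pseudometric X \<rho>X" and gen: "dynamically_generating \<Gamma> X \<alpha> \<rho>X"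
    and \<alpha>: "\<And>s. s \<in> carrier \<Gamma> \<Longrightarrow> continuous_map X X (\<alpha> s)" and \<epsilon>: "\<epsilon> > 0"
  shows "\<exists>F e. finite F \<and> F \<subseteq> carrier \<Gamma> \<and> 0 < e \<and> (\<forall>x\<in>topspace X. \<forall>y\<in>topspace X.
           (\<forall>s\<in>F. \<rho>X (\<alpha> s x) (\<alpha> s y) < e) \<longrightarrow> \<rho> x y < \<epsilon>)"
proof -
  let ?P = "prod_topology X X"
  have cp: "continuous_pseudometric X \<rho>"
    by (rule compatible_metric_imp_continuous_pseudometric[OF \<rho>])
  have "compact_space ?P" using X compact_space_prod_topology by blast
  then have "\<exists>F e. finite F \<and> F \<subseteq> carrier \<Gamma> \<and> 0 < e \<and> (\<forall>z\<in>topspace ?P.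
      (\<forall>s\<in>F. \<rho>X (\<alpha> s (fst z)) (\<alpha> s (snd z)) < e) \<longrightarrow> \<rho> (fst z) (snd z) < \<epsilon>)"
  proof (rule compact_finite_witness)
    show "continuous_map ?P euclideanreal (\<lambda>z. \<rho> (fst z) (snd z))"
      by (intro continuous_map_pseudometric[OF cp] continuous_map_fst continuous_map_snd)
    show "continuous_map ?P euclideanreal (\<lambda>z. \<rho>X (\<alpha> s (fst z)) (\<alpha> s (snd z)))"
      if "s \<in> carrier \<Gamma>" for s
      using continuous_map_compose[OF continuous_map_fst \<alpha>[OF that]]
        continuous_map_compose[OF continuous_map_snd \<alpha>[OF that]]
      by (intro continuous_map_pseudometric[OF \<rho>X]) (auto simp: o_def)
    fix z assume z: "z \<in> topspace ?P" "\<epsilon> \<le> \<rho> (fst z) (snd z)"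
    then have "fst z \<noteq> snd z" using \<epsilon> continuous_pseudometric_self[OF cp] by force
    then have "(SUP s\<in>carrier \<Gamma>. ereal (\<rho>X (\<alpha> s (fst z)) (\<alpha> s (snd z)))) > 0"
      using gen z unfolding dynamically_generating_def by auto
    then show "\<exists>s\<in>carrier \<Gamma>. 0 < \<rho>X (\<alpha> s (fst z)) (\<alpha> s (snd z))"
      by (auto simp: less_SUP_iff)
  qed
  then show ?thesis by (elim exE) (metis (no_types, lifting) SigmaI fst_conv snd_conv topspace_prod_topology)
qed

section \<open>Mean-square distances and nearly equivariant maps\<close>

lemma rho_2_le_iff:
  assumes "n > 0" "\<delta> \<ge> 0"
  shows "rho_2 n \<rho> \<phi> \<psi> \<le> \<delta> \<longleftrightarrow> (\<Sum>v\<in>{1..n}. (\<rho> (\<phi> v) (\<psi> v))\<^sup>2) \<le> real n * \<delta>\<^sup>2"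
proof -
  have "rho_2 n \<rho> \<phi> \<psi> \<le> \<delta> \<longleftrightarrow> 1 / real n * (\<Sum>v\<in>{1..n}. (\<rho> (\<phi> v) (\<psi> v))\<^sup>2) \<le> \<delta>\<^sup>2"
    unfolding rho_2_def using assms(2) real_sqrt_le_iff[of _ "\<delta>\<^sup>2"] by simp
  also have "\<dots> \<longleftrightarrow> (\<Sum>v\<in>{1..n}. (\<rho> (\<phi> v) (\<psi> v))\<^sup>2) \<le> real n * \<delta>\<^sup>2"
    using assms(1) by (simp add: field_simps)
  finally show ?thesis .
qed

text \<open>Each counted \<open>v\<close> contributes at least \<open>t\<^sup>2\<close> to the sum
  of squares. This limits the positions where a map in \<open>Map_sofic\<close> is far from
  equivariant.\<close>

lemma rho_2_chebyshev:
  fixes t \<delta> :: real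
  assumes "n > 0" "\<delta> \<ge> 0" "t > 0" "rho_2 n \<rho> \<phi> \<psi> \<le> \<delta>"
  shows "card {v \<in> {1..n}. t < \<rho> (\<phi> v) (\<psi> v)} * t\<^sup>2 \<le> real n * \<delta>\<^sup>2"
proof -
  let ?V = "{v \<in> {1..n}. t < \<rho> (\<phi> v) (\<psi> v)}"
  have "card ?V * t\<^sup>2 = (\<Sum>v\<in>?V. t\<^sup>2)" by simp
  also have "\<dots> \<le> (\<Sum>v\<in>?V. (\<rho> (\<phi> v) (\<psi> v))\<^sup>2)"
    using assms(3) by (intro sum_mono power_mono) auto
  also have "\<dots> \<le> (\<Sum>v\<in>{1..n}. (\<rho> (\<phi> v) (\<psi> v))\<^sup>2)" by (intro sum_mono2) auto
  also have "\<dots> \<le> real n * \<delta>\<^sup>2" using assms rho_2_le_iff by blast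
  finally show ?thesis .
qed

text \<open>Passes from the compatible metric of the mean dimension to the pseudometric of the
  entropy, with one \<open>\<delta>'\<close> for all \<open>F\<close>, \<open>n\<close> and
  \<open>\<tau>\<close>. Large values of \<open>\<rho>X\<close> occur only where
  \<open>\<rho>\<close> is at least some \<open>t\<close>, and the mean square of
  \<open>\<rho>\<close> controls these positions.\<close>

lemma Map_sofic_subset:
  assumes X: "compact_space X" and \<rho>: "compatible_metric X \<rho>"
    and \<rho>X: "continuous_pseudometric X \<rho>X" and \<delta>: "\<delta> > 0"
  shows "\<exists>\<delta>'>0. \<forall>F n \<tau>. n > 0 \<longrightarrow>
    (\<forall>s\<in>F. \<alpha> s ` topspace X \<subseteq> topspace X \<and> \<tau> s ` {1..n} \<subseteq> {1..n}) \<longrightarrow>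
    Map_sofic X \<alpha> \<rho> F \<delta>' n \<tau> \<subseteq> Map_sofic X \<alpha> \<rho>X F \<delta> n \<tau>"
proof -
  obtain t where t: "t > 0" and small: "\<And>x y. x \<in> topspace X \<Longrightarrow> y \<in> topspace X \<Longrightarrow>
      \<rho> x y < t \<Longrightarrow> \<rho>X x y < \<delta> / 2"
    using pseudometric_uniformly_small[OF X \<rho> \<rho>X, of "\<delta> / 2"] \<delta> by auto
  obtain M where M: "M > 0" and bd: "\<And>x y. x \<in> topspace X \<Longrightarrow> y \<in> topspace X \<Longrightarrow> \<rho>X x y \<le> M"
    using pseudometric_bounded[OF X \<rho>X] by auto
  \<comment> \<open>Chosen so that \<open>(M / t) * ?d = \<delta> / 2\<close>; the two summands in
    \<open>pt\<close> then average to at most \<open>\<delta>\<^sup>2 / 2\<close>.\<close>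
  let ?d = "t * \<delta> / (2 * M)"
  \<comment> \<open>Either \<open>\<rho> x y < t\<close>, and \<open>\<rho>X x y\<close> is below
    \<open>\<delta> / 2\<close>, or
    \<open>\<rho>X x y \<le> M \<le> M / t * \<rho> x y\<close>.\<close>
  have pt: "(\<rho>X x y)\<^sup>2 \<le> (\<delta> / 2)\<^sup>2 + (M / t)\<^sup>2 * (\<rho> x y)\<^sup>2"
    if x: "x \<in> topspace X" and y: "y \<in> topspace X" for x y
  proof (cases "\<rho> x y < t")
    case True
    then have "(\<rho>X x y)\<^sup>2 \<le> (\<delta> / 2)\<^sup>2"
      using small[OF x y True] continuous_pseudometricD(1)[OF \<rho>X x y] by (intro power_mono) auto
    moreover have "0 \<le> (M / t)\<^sup>2 * (\<rho> x y)\<^sup>2" by (intro mult_nonneg_nonneg) auto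
    ultimately show ?thesis by linarith
  next
    case False
    have "\<rho>X x y \<le> M / t * \<rho> x y"
      using bd[OF x y] False M t
      by (smt (verit, best) divide_self_if mult_left_mono divide_pos_pos nonzero_eq_divide_eq times_divide_eq_left)
    then have "(\<rho>X x y)\<^sup>2 \<le> (M / t * \<rho> x y)\<^sup>2"
      using continuous_pseudometricD(1)[OF \<rho>X x y] by (intro power_mono) auto
    then show ?thesis using zero_le_power2[of "\<delta> / 2"] by (simp only: power_mult_distrib)
  qed
  have "rho_2 n \<rho>X \<phi> \<psi> \<le> \<delta>"
    if n: "n > 0" and r: "rho_2 n \<rho> \<phi> \<psi> \<le> ?d"
      and \<phi>: "\<And>v. v \<in> {1..n} \<Longrightarrow> \<phi> v \<in> topspace X \<and> \<psi> v \<in> topspace X" for n \<phi> \<psi>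
  proof -
    have s: "(\<Sum>v\<in>{1..n}. (\<rho> (\<phi> v) (\<psi> v))\<^sup>2) \<le> real n * ?d\<^sup>2"
      using r n M t \<delta> by (subst (asm) rho_2_le_iff) auto
    have "(\<Sum>v\<in>{1..n}. (\<rho>X (\<phi> v) (\<psi> v))\<^sup>2)
        \<le> (\<Sum>v\<in>{1..n}. (\<delta> / 2)\<^sup>2 + (M / t)\<^sup>2 * (\<rho> (\<phi> v) (\<psi> v))\<^sup>2)"
      using \<phi> by (intro sum_mono pt) auto
    also have "\<dots> = real n * (\<delta> / 2)\<^sup>2 + (M / t)\<^sup>2 * (\<Sum>v\<in>{1..n}. (\<rho> (\<phi> v) (\<psi> v))\<^sup>2)"
      by (simp add: sum.distrib sum_distrib_left)
    also have "\<dots> \<le> real n * (\<delta> / 2)\<^sup>2 + (M / t)\<^sup>2 * (real n * ?d\<^sup>2)"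
      using s by (intro add_left_mono mult_left_mono) auto
    also have "\<dots> = real n * \<delta>\<^sup>2 / 2"
      using M t by (simp add: field_simps power2_eq_square)
    also have "\<dots> \<le> real n * \<delta>\<^sup>2" by simp
    finally show ?thesis using n \<delta> by (simp add: rho_2_le_iff)
  qed
  note main = this
  show ?thesis
  proof (intro exI[of _ ?d] conjI allI impI subsetI)
    show "?d > 0" using t M \<delta> by simp
    fix F n \<tau> \<phi>
    assume n: "n > (0::nat)"
      and F: "\<forall>s\<in>F. \<alpha> s ` topspace X \<subseteq> topspace X \<and> \<tau> s ` {1..n} \<subseteq> {1..n}"
      and \<phi>: "\<phi> \<in> Map_sofic X \<alpha> \<rho> F ?d n \<tau>"
    have \<phi>X: "\<phi> v \<in> topspace X" if "v \<in> {1..n}" for v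
      using \<phi> that by (auto simp: Map_sofic_def power_space_def PiE_def Pi_def)
    have "rho_2 n \<rho>X (\<lambda>v. \<alpha> s (\<phi> v)) (\<phi> \<circ> \<tau> s) \<le> \<delta>" if s: "s \<in> F" for s
    proof (rule main[OF n])
      show "rho_2 n \<rho> (\<lambda>v. \<alpha> s (\<phi> v)) (\<phi> \<circ> \<tau> s) \<le> ?d"
        using \<phi> s by (auto simp: Map_sofic_def)
      show "\<alpha> s (\<phi> v) \<in> topspace X \<and> (\<phi> \<circ> \<tau> s) v \<in> topspace X" if "v \<in> {1..n}" for v
        using F s \<phi>X that by (simp add: image_subset_iff)
    qed
    then show "\<phi> \<in> Map_sofic X \<alpha> \<rho>X F \<delta> n \<tau>"
      using \<phi> by (auto simp: Map_sofic_def)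
  qed
qed

section \<open>Mapping a fibre to a skeleton\<close>

definition clamp01 :: "real \<Rightarrow> real" where
  "clamp01 z = max 0 (min 1 z)"

text \<open>Equal \<open>g1\<close> coordinates force
  \<open>\<rho>X (\<phi> v) (\<phi>' v) < 3 * r\<close>, and two equivariance errors of
  \<open>r\<close> raise this to the \<open>5 * r\<close> of \<open>gen\<close>. At most
  \<open>m\<close> of the \<open>g1\<close> coordinates are fractional, and at most
  \<open>1 + card A'\<close> of the \<open>g2\<close> coordinates at each of at most
  \<open>p\<close> positions where equivariance fails.\<close>

lemma Wdim_fibre_le:
  fixes \<alpha> :: "'g \<Rightarrow> 'x \<Rightarrow> 'x" and \<tau> :: "'g \<Rightarrow> nat \<Rightarrow> nat"
  assumes \<rho>: "continuous_pseudometric X \<rho>" and \<rho>X: "continuous_pseudometric X \<rho>X"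
    and F: "finite F" and \<alpha>: "\<And>s. s \<in> F \<Longrightarrow> continuous_map X X (\<alpha> s)"
    and \<tau>: "\<And>s v. s \<in> F \<Longrightarrow> v \<in> {1..n} \<Longrightarrow> \<tau> s v \<in> {1..n}"
    and r: "r > 0" and gen: "\<And>x x'. \<lbrakk>x \<in> topspace X; x' \<in> topspace X;
      \<And>s. s \<in> F \<Longrightarrow> \<rho>X (\<alpha> s x) (\<alpha> s x') < 5 * r\<rbrakk> \<Longrightarrow> \<rho> x x' < \<epsilon>"
    and A: "finite A" "A \<subseteq> topspace X" "\<And>x. x \<in> topspace X \<Longrightarrow> \<exists>a\<in>A. \<rho>X x a < r"
    and A': "finite A'" "A' \<subseteq> topspace X"
      "\<And>x. x \<in> topspace X \<Longrightarrow> \<exists>a\<in>A'. \<rho> x a < min \<epsilon> 1 / 2"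
    and n: "n > 0" and K: "K \<subseteq> topspace (power_space X n)"
    and E: "finite E" "E \<subseteq> K"
      "\<And>\<phi>. \<phi> \<in> K \<Longrightarrow> \<exists>e\<in>E. \<forall>v\<in>{1..n}. \<rho>X (\<phi> v) (e v) < \<epsilon>'"
    and L: "L > 0" "\<epsilon>' / r \<le> 1 / (4 * real L)"
    and count: "card E * 2 ^ (n * card A) < L ^ (m + 1)"
    and bad: "\<And>\<phi>. \<phi> \<in> K \<Longrightarrow>
      card {v \<in> {1..n}. \<exists>s\<in>F. r < \<rho>X (\<alpha> s (\<phi> v)) (\<phi> (\<tau> s v))} \<le> p"
  shows "Wdim \<epsilon> (subtopology (power_space X n) K) (rho_inf n \<rho>)
           \<le> ereal (real (m + p * (1 + card A')))"
proof -
  \<comment> \<open>Normalised so that \<open>y < 0\<close> means distance below \<open>r\<close>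
    and \<open>y < 1\<close> distance below \<open>2 * r\<close>. The values \<open>mid l\<close>
    for \<open>l < L\<close> are the midpoints of \<open>L\<close> equal parts of the unit
    interval.\<close>
  define y where "y e = (\<lambda>(v, a). \<rho>X (e v) a / r - 1)" for e :: "nat \<Rightarrow> 'x" and c :: "nat \<times> 'x"
  define mid where "mid l = (2 * real l + 1) / (2 * real L)" for l
  define V where "V = {1..n}"
  let ?C1 = "V \<times> A"
  have KX: "\<phi> v \<in> topspace X" if "\<phi> \<in> K" "v \<in> V" for \<phi> v
    using K that by (auto simp: power_space_def PiE_def Pi_def V_def)
  have mid_diff: "l = l'" if "\<bar>z - mid l\<bar> < 1 / (2 * real L)" "\<bar>z - mid l'\<bar> < 1 / (2 * real L)" for z l l'
  proof -
    have "\<bar>mid l - mid l'\<bar> < 1 / real L" using that by (simp add: abs_if split: if_splits)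
    moreover have "mid l - mid l' = (real l - real l') / real L"
      unfolding mid_def using L(1) by (simp add: field_simps)
    ultimately have "\<bar>real l - real l'\<bar> < 1" using L(1) by (simp add: divide_less_cancel)
    then show ?thesis by linarith
  qed
  \<comment> \<open>These windows are twice as wide as the transition regions of \<open>g1\<close>,
    which have half-width \<open>1 / (4 * L)\<close>. The difference absorbs the change of
    \<open>y\<close>, less than \<open>\<epsilon>' / r\<close>, from a point of \<open>K\<close> to
    its neighbour in \<open>E\<close>.\<close>
  have "\<exists>\<xi>. (\<forall>c\<in>?C1. \<xi> c < L) \<and>
      (\<forall>e\<in>E. card {c \<in> ?C1. \<bar>y e c - mid (\<xi> c)\<bar> < 1 / (2 * real L)} \<le> m)"
  proof (rule exists_choice_few_excluded
      [where B = "\<lambda>e c l. \<bar>y e c - mid l\<bar> < 1 / (2 * real L)"])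
    show "card E * 2 ^ card (V \<times> A) < L ^ (m + 1)"
      using count by (simp add: V_def card_cartesian_product)
    show "finite (V \<times> A)" using A(1) by (simp add: V_def)
    show "finite E" by (fact E(1))
    show "l = l'" if "\<bar>y e c - mid l\<bar> < 1 / (2 * real L)" "\<bar>y e c - mid l'\<bar> < 1 / (2 * real L)"
      for e c l l'
      using that by (rule mid_diff)
  qed
  then obtain \<xi> where \<xi>_all: "\<forall>c\<in>?C1. \<xi> c < L"
    "\<forall>e\<in>E. card {c \<in> ?C1. \<bar>y e c - mid (\<xi> c)\<bar> < 1 / (2 * real L)} \<le> m"
    by (elim exE conjE)
  have \<xi>L: "\<xi> c < L" if "c \<in> ?C1" for c using \<xi>_all(1) that by (rule bspec)
  have \<xi>: "card {c \<in> ?C1. \<bar>y e c - mid (\<xi> c)\<bar> < 1 / (2 * real L)} \<le> m" if "e \<in> E" for e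
    using \<xi>_all(2) that by (rule bspec)
  \<comment> \<open>A continuous cut-off that vanishes exactly when all equivariance errors at
    \<open>v\<close> are at most \<open>r\<close>.\<close>
  define defect where
    "defect v \<phi> = (\<Sum>s\<in>F. max 0 (\<rho>X (\<alpha> s (\<phi> v)) (\<phi> (\<tau> s v)) - r))" for v and \<phi> :: "nat \<Rightarrow> 'x"
  define g1 where "g1 c \<phi> = clamp01 ((y \<phi> c - mid (\<xi> c)) * (2 * real L) + 1 / 2)" for c \<phi>
  \<comment> \<open>The coordinate with \<open>None\<close> records the cut-off itself, so that it
    can be cancelled from those with \<open>Some a\<close>.\<close>
  define g2 where "g2 = (\<lambda>(v, a) \<phi>. min 1 (defect v \<phi>) *
    (case a of None \<Rightarrow> 1 | Some a \<Rightarrow> min 1 (\<rho> (\<phi> v) a)))"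
  let ?C2 = "V \<times> insert None (Some ` A')"
  let ?g = "\<lambda>c. case c of Inl c \<Rightarrow> g1 c | Inr c \<Rightarrow> g2 c"
  let ?K = "subtopology (power_space X n) K"
  have topK: "topspace ?K = K" using K by auto
  have g1_frac: "\<bar>y \<phi> c - mid (\<xi> c)\<bar> < 1 / (4 * real L)" if "g1 c \<phi> \<notin> {0, 1}" for c \<phi>
  proof -
    have "\<bar>(y \<phi> c - mid (\<xi> c)) * (2 * real L)\<bar> < 1 / 2"
      using that unfolding g1_def clamp01_def by (auto simp: max_def min_def abs_if split: if_splits)
    then have "\<bar>y \<phi> c - mid (\<xi> c)\<bar> * (2 * real L) < 1 / 2" by (simp add: abs_mult)
    then show ?thesis using L(1) by (simp add: field_simps)
  qed
  have defect0: "defect v \<phi> = 0 \<longleftrightarrow> (\<forall>s\<in>F. \<rho>X (\<alpha> s (\<phi> v)) (\<phi> (\<tau> s v)) \<le> r)" for v \<phi>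
    unfolding defect_def using F by (subst sum_nonneg_eq_0_iff) (auto simp: max_def)
  have defect_nonneg: "0 \<le> defect v \<phi>" for v \<phi>
    unfolding defect_def by (intro sum_nonneg) auto
  have \<phi>v: "continuous_map ?K X (\<lambda>\<phi>. \<phi> v)" if "v \<in> V" for v
    using that unfolding power_space_def V_def
    by (intro continuous_map_from_subtopology continuous_map_product_projection)
  show ?thesis
  proof (rule Wdim_le_coordinates[where C = "?C1 <+> ?C2" and g = ?g])
    show "finite (?C1 <+> ?C2)" using A(1) A'(1) by (auto simp: V_def)
  next
    fix c assume "c \<in> ?C1 <+> ?C2"
    then show "continuous_map ?K euclideanreal (?g c)"
    proof (elim PlusE)
      fix c1 assume c1: "c1 \<in> ?C1" "c = Inl c1"
      obtain v a where va: "c1 = (v, a)" by (cases c1)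
      have "continuous_map ?K euclideanreal (\<lambda>\<phi>. \<rho>X (\<phi> v) a)"
        using c1 va A(2) by (intro continuous_map_pseudometric[OF \<rho>X] \<phi>v) auto
      then show ?thesis using r unfolding c1 va y_def g1_def clamp01_def
        by (auto intro!: continuous_intros)
    next
      fix c2 assume c2: "c2 \<in> ?C2" "c = Inr c2"
      obtain v a where va: "c2 = (v, a)" by (cases c2)
      have v: "v \<in> V" using c2 va by auto
      have "continuous_map ?K euclideanreal (\<lambda>\<phi>. \<rho>X (\<alpha> s (\<phi> v)) (\<phi> (\<tau> s v)))" if "s \<in> F" for s
        using continuous_map_compose[OF \<phi>v[OF v] \<alpha>[OF that]] \<tau>[OF that, of v] v
        by (intro continuous_map_pseudometric[OF \<rho>X] \<phi>v) (auto simp: o_def V_def)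
      then have "continuous_map ?K euclideanreal (defect v)"
        unfolding defect_def using F by (auto intro!: continuous_intros)
      moreover have "continuous_map ?K euclideanreal (\<lambda>\<phi>. \<rho> (\<phi> v) b)" if "b \<in> A'" for b
        using that A'(2) v by (intro continuous_map_pseudometric[OF \<rho>] \<phi>v) auto
      ultimately show ?thesis using c2 va unfolding g2_def
        by (auto intro!: continuous_intros)
    qed
  next
    fix c \<phi> assume "c \<in> ?C1 <+> ?C2" and \<phi>: "\<phi> \<in> topspace ?K"
    then show "?g c \<phi> \<in> {0..1}"
    proof (elim PlusE)
      fix c2 assume c2: "c2 \<in> ?C2" "c = Inr c2"
      obtain v a where va: "c2 = (v, a)" by (cases c2)
      have "0 \<le> (case a of None \<Rightarrow> 1 | Some a \<Rightarrow> min 1 (\<rho> (\<phi> v) a))"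
        using c2 va A'(2) KX \<phi> topK continuous_pseudometricD(1)[OF \<rho>] by (auto split: option.split)
      moreover have "(case a of None \<Rightarrow> 1 | Some a \<Rightarrow> min 1 (\<rho> (\<phi> v) a)) \<le> 1"
        by (auto split: option.split)
      ultimately show ?thesis
        using defect_nonneg[of v \<phi>] c2 va by (auto simp: g2_def intro!: mult_le_one)
    qed (auto simp: g1_def clamp01_def)
  next
    fix \<phi> assume "\<phi> \<in> topspace ?K"
    then have \<phi>: "\<phi> \<in> K" using topK by simp
    then obtain e where e: "e \<in> E" and close: "\<And>v. v \<in> V \<Longrightarrow> \<rho>X (\<phi> v) (e v) < \<epsilon>'"
      using E(3)[OF \<phi>] by (auto simp: V_def)
    have eK: "e \<in> K" using e E(2) by auto
    let ?B1 = "{c \<in> ?C1. \<bar>y e c - mid (\<xi> c)\<bar> < 1 / (2 * real L)}"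
    let ?B2 = "{v \<in> {1..n}. \<exists>s\<in>F. r < \<rho>X (\<alpha> s (\<phi> v)) (\<phi> (\<tau> s v))} \<times> insert None (Some ` A')"
    have "c \<in> Inl ` ?B1 \<union> Inr ` ?B2" if c: "c \<in> ?C1 <+> ?C2" "?g c \<phi> \<notin> {0, 1}" for c
      using c(1)
    proof (elim PlusE)
      fix c1 assume c1: "c1 \<in> ?C1" "c = Inl c1"
      obtain v a where va: "c1 = (v, a)" by (cases c1)
      have va': "v \<in> V" "a \<in> topspace X" using c1 va A(2) by auto
      have "\<bar>\<rho>X (\<phi> v) a - \<rho>X (e v) a\<bar> \<le> \<rho>X (\<phi> v) (e v)"
        using continuous_pseudometricD(2,3)[OF \<rho>X] KX[OF \<phi> va'(1)] KX[OF eK va'(1)] va'(2)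
        by (smt (verit))
      also have "\<dots> < \<epsilon>'" by (rule close[OF va'(1)])
      finally have "\<bar>\<rho>X (\<phi> v) a - \<rho>X (e v) a\<bar> / r < \<epsilon>' / r" using r by (simp add: divide_strict_right_mono)
      moreover have "y \<phi> c1 - y e c1 = (\<rho>X (\<phi> v) a - \<rho>X (e v) a) / r"
        unfolding y_def va by (simp add: diff_divide_distrib)
      ultimately have "\<bar>y \<phi> c1 - y e c1\<bar> < 1 / (4 * real L)" using L(2) r by simp
      moreover have "\<bar>y \<phi> c1 - mid (\<xi> c1)\<bar> < 1 / (4 * real L)"
        using g1_frac[of c1 \<phi>] c(2) c1(2) by simp
      ultimately have "\<bar>y e c1 - mid (\<xi> c1)\<bar> < 1 / (4 * real L) + 1 / (4 * real L)" by linarith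
      then have "c1 \<in> ?B1" using c1(1) by simp
      then show ?thesis using c1(2) by blast
    next
      fix c2 assume c2: "c2 \<in> ?C2" "c = Inr c2"
      obtain v a where va: "c2 = (v, a)" by (cases c2)
      have "defect v \<phi> \<noteq> 0" using c(2) c2(2) va by (auto simp: g2_def)
      then have "\<exists>s\<in>F. r < \<rho>X (\<alpha> s (\<phi> v)) (\<phi> (\<tau> s v))" using defect0 by force
      then have "c2 \<in> ?B2" using c2(1) va unfolding V_def by blast
      then show ?thesis using c2(2) by blast
    qed
    then have "{c \<in> ?C1 <+> ?C2. ?g c \<phi> \<notin> {0, 1}} \<subseteq> Inl ` ?B1 \<union> Inr ` ?B2" by blast
    then have "card {c \<in> ?C1 <+> ?C2. ?g c \<phi> \<notin> {0, 1}} \<le> card (Inl ` ?B1 \<union> Inr ` ?B2)"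
      using A(1) A'(1) by (intro card_mono) (auto simp: V_def)
    also have "\<dots> \<le> card ?B1 + card ?B2"
      by (rule order_trans[OF card_Un_le]) (simp add: card_image)
    also have "\<dots> \<le> m + p * (1 + card A')"
    proof (rule add_mono)
      show "card ?B1 \<le> m" by (rule \<xi>[OF e])
      have "card (insert None (Some ` A')) = 1 + card A'"
        using A'(1) by (subst card_insert_disjoint) (auto simp: card_image)
      then show "card ?B2 \<le> p * (1 + card A')"
        using bad[OF \<phi>] by (simp only: card_cartesian_product mult_le_mono1)
    qed
    finally show "card {c \<in> ?C1 <+> ?C2. ?g c \<phi> \<notin> {0, 1}} \<le> m + p * (1 + card A')" .
  next
    fix \<phi> \<phi>' assume "\<phi> \<in> topspace ?K" "\<phi>' \<in> topspace ?K"
      and eq: "\<And>c. c \<in> ?C1 <+> ?C2 \<Longrightarrow> ?g c \<phi> = ?g c \<phi>'"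
    then have \<phi>: "\<phi> \<in> K" and \<phi>': "\<phi>' \<in> K" using topK by simp_all
    have eq1: "g1 c \<phi> = g1 c \<phi>'" if "c \<in> ?C1" for c using eq[of "Inl c"] that by auto
    have eq2: "g2 c \<phi> = g2 c \<phi>'" if "c \<in> ?C2" for c using eq[of "Inr c"] that by auto
    have near: "\<rho>X (\<phi> v) (\<phi>' v) < 3 * r" if v: "v \<in> V" for v
    proof -
      obtain a where a: "a \<in> A" "\<rho>X (\<phi> v) a < r" using A(3)[OF KX[OF \<phi> v]] by blast
      let ?x = "mid (\<xi> (v, a))"
      have va: "(v, a) \<in> ?C1" using v a by simp
      have "real (\<xi> (v, a)) + 1 \<le> real L" using \<xi>L[OF va] by simp
      moreover have "?x * real L = real (\<xi> (v, a)) + 1 / 2"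
        unfolding mid_def using L(1) by (simp add: field_simps)
      ultimately have x: "1 / 2 \<le> ?x * real L" "?x * real L \<le> real L - 1 / 2" by linarith+
      \<comment> \<open>A distance below \<open>r\<close> from \<open>a\<close> lies under every
        transition region, so \<open>g1\<close> is 0. For \<open>\<phi>'\<close> the value 0 still
        keeps \<open>y\<close> below 1, that is, the distance below \<open>2 * r\<close>.\<close>
      have "y \<phi> (v, a) < 0" using a r unfolding y_def by simp
      then have y0: "y \<phi> (v, a) * (2 * real L) \<le> 0" by (simp add: mult_nonpos_nonneg)
      have lin: "(y f (v, a) - ?x) * (2 * real L) + 1 / 2
        = y f (v, a) * (2 * real L) - 2 * (?x * real L) + 1 / 2" for f
        by (simp add: algebra_simps)
      have "(y \<phi> (v, a) - ?x) * (2 * real L) + 1 / 2 \<le> 0"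
        using y0 x(1) lin[of \<phi>] by linarith
      then have "g1 (v, a) \<phi> = 0" unfolding g1_def clamp01_def by simp
      then have "g1 (v, a) \<phi>' = 0" using eq1[OF va] by simp
      then have "(y \<phi>' (v, a) - ?x) * (2 * real L) + 1 / 2 \<le> 0"
        unfolding g1_def clamp01_def by (auto simp: max_def min_def split: if_splits)
      then have "y \<phi>' (v, a) * (2 * real L) < 2 * real L" using x(2) lin[of \<phi>'] by linarith
      then have "y \<phi>' (v, a) < 1" using L(1) by simp
      then have "\<rho>X (\<phi>' v) a < 2 * r" using r unfolding y_def by (simp add: field_simps)
      then show ?thesis
        using a continuous_pseudometricD(2,3)[OF \<rho>X] KX[OF \<phi> v] KX[OF \<phi>' v] A(2)
        by (smt (verit) subsetD)
    qed
    have "\<rho> (\<phi> v) (\<phi>' v) < \<epsilon>" if v: "v \<in> V" for v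
    proof (cases "defect v \<phi> = 0")
      case True
      have "(v, None) \<in> ?C2" using v by simp
      from eq2[OF this] have "min 1 (defect v \<phi>) = min 1 (defect v \<phi>')" by (simp add: g2_def)
      then have True': "defect v \<phi>' = 0" using True by (simp add: min_def split: if_splits)
      show ?thesis
      proof (rule gen[OF KX[OF \<phi> v] KX[OF \<phi>' v]])
        fix s assume s: "s \<in> F"
        let ?w = "\<tau> s v"
        have w: "?w \<in> V" using \<tau>[OF s] v by (simp add: V_def)
        have "\<alpha> s x \<in> topspace X" if "x \<in> topspace X" for x
          using \<alpha>[OF s] that by (auto simp: continuous_map_def)
        then have in_X: "\<alpha> s (\<phi> v) \<in> topspace X" "\<alpha> s (\<phi>' v) \<in> topspace X"
          "\<phi> ?w \<in> topspace X" "\<phi>' ?w \<in> topspace X"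
          using KX \<phi> \<phi>' v w by auto
        have "\<rho>X (\<alpha> s (\<phi> v)) (\<phi> ?w) \<le> r" "\<rho>X (\<alpha> s (\<phi>' v)) (\<phi>' ?w) \<le> r"
          using True True' s defect0 by auto
        moreover have "\<rho>X (\<phi> ?w) (\<phi>' ?w) < 3 * r" by (rule near[OF w])
        moreover have "\<rho>X (\<alpha> s (\<phi> v)) (\<alpha> s (\<phi>' v))
          \<le> \<rho>X (\<alpha> s (\<phi> v)) (\<phi> ?w) + \<rho>X (\<phi> ?w) (\<alpha> s (\<phi>' v))"
          "\<rho>X (\<phi> ?w) (\<alpha> s (\<phi>' v)) \<le> \<rho>X (\<phi> ?w) (\<phi>' ?w) + \<rho>X (\<phi>' ?w) (\<alpha> s (\<phi>' v))"
          by (intro continuous_pseudometricD(3)[OF \<rho>X] in_X)+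
        moreover have "\<rho>X (\<phi>' ?w) (\<alpha> s (\<phi>' v)) = \<rho>X (\<alpha> s (\<phi>' v)) (\<phi>' ?w)"
          by (intro continuous_pseudometricD(2)[OF \<rho>X] in_X)
        ultimately show "\<rho>X (\<alpha> s (\<phi> v)) (\<alpha> s (\<phi>' v)) < 5 * r" by linarith
      qed
    next
      case False
      let ?b = "min 1 (defect v \<phi>)"
      have "(v, None) \<in> ?C2" using v by simp
      from eq2[OF this] have b': "?b = min 1 (defect v \<phi>')" by (simp add: g2_def)
      have b: "?b > 0" using False defect_nonneg[of v \<phi>] by simp
      obtain a where a: "a \<in> A'" "\<rho> (\<phi> v) a < min \<epsilon> 1 / 2" using A'(3)[OF KX[OF \<phi> v]] by blast
      have "(v, Some a) \<in> ?C2" using v a by simp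
      from eq2[OF this] have "?b * min 1 (\<rho> (\<phi> v) a) = ?b * min 1 (\<rho> (\<phi>' v) a)"
        using b' by (simp add: g2_def)
      then have "min 1 (\<rho> (\<phi> v) a) = min 1 (\<rho> (\<phi>' v) a)" using b by simp
      \<comment> \<open>The net radius is at most \<open>1 / 2\<close>, so the truncation at 1 is
        inactive, and both points lie within \<open>\<epsilon> / 2\<close> of
        \<open>a\<close>.\<close>
      then have "\<rho> (\<phi>' v) a = \<rho> (\<phi> v) a" using a(2) by (auto simp: min_def split: if_splits)
      then show ?thesis
        using a continuous_pseudometricD(2,3)[OF \<rho>] KX[OF \<phi> v] KX[OF \<phi>' v] A'(2)
        by (smt (verit) subsetD field_sum_of_halves)
    qed
    then have "\<rho> (\<phi> v) (\<phi>' v) < \<epsilon>" if "v \<in> {1..n}" for v using that by (simp add: V_def)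
    then show "rho_inf n \<rho> \<phi> \<phi>' < \<epsilon>" unfolding rho_inf_def using n by simp
  qed
qed

section \<open>Separated sets in fibres and the choice of parameters\<close>

lemma rho_inf_less_iff:
  "n > 0 \<Longrightarrow> rho_inf n \<rho> \<phi> \<psi> < c \<longleftrightarrow> (\<forall>v\<in>{1..n}. \<rho> (\<phi> v) (\<psi> v) < c)"
  unfolding rho_inf_def by simp

lemma rho_inf_le_iff:
  "n > 0 \<Longrightarrow> rho_inf n \<rho> \<phi> \<psi> \<le> c \<longleftrightarrow> (\<forall>v\<in>{1..n}. \<rho> (\<phi> v) (\<psi> v) \<le> c)"
  unfolding rho_inf_def by simp

text \<open>A largest separated subset of \<open>K\<close> is a net in \<open>K\<close>. Points of
  one fibre have the same image in \<open>Y\<close>, so they meet the condition with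
  \<open>\<theta>\<close>, and the separation number of \<open>M\<close> bounds the size of this
  set.\<close>

lemma fibre_net:
  assumes \<rho>X: "continuous_pseudometric X \<rho>X" and \<rho>Y: "continuous_pseudometric Y \<rho>Y"
    and \<pi>: "\<pi> ` topspace X \<subseteq> topspace Y" and n: "n > 0"
    and K: "K \<subseteq> fibre X \<pi> n \<psi>" "K \<subseteq> M" and pos: "\<epsilon> > 0" "\<theta> > 0"
    and fin: "sep_number n \<pi> \<rho>X \<rho>Y M \<epsilon> \<theta> \<le> ereal B"
  shows "\<exists>E. finite E \<and> E \<subseteq> K \<and> ereal (card E) \<le> sep_number n \<pi> \<rho>X \<rho>Y M \<epsilon> \<theta> \<and>
           (\<forall>\<phi>\<in>K. \<exists>e\<in>E. \<forall>v\<in>{1..n}. \<rho>X (\<phi> v) (e v) < \<epsilon>)"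
proof -
  define sep where "sep E \<longleftrightarrow> finite E \<and> E \<subseteq> K \<and>
    (\<forall>\<phi>\<in>E. \<forall>\<phi>'\<in>E. \<phi> \<noteq> \<phi>' \<longrightarrow> rho_inf n \<rho>X \<phi> \<phi>' \<ge> \<epsilon>)" for E
  have KX: "\<phi> v \<in> topspace X" if "\<phi> \<in> K" "v \<in> {1..n}" for \<phi> v
    using K that by (auto simp: fibre_def power_space_def PiE_def Pi_def)
  have Y: "rho_inf n \<rho>Y (\<pi> \<circ> \<phi>) (\<pi> \<circ> \<phi>') \<le> \<theta>" if "\<phi> \<in> K" "\<phi>' \<in> K" for \<phi> \<phi>'
    unfolding rho_inf_le_iff[OF n]
  proof
    fix v assume v: "v \<in> {1..n}"
    have "compose {1..n} \<pi> \<phi> = \<psi>" "compose {1..n} \<pi> \<phi>' = \<psi>"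
      using that K(1) unfolding fibre_def by blast+
    then have "compose {1..n} \<pi> \<phi> v = compose {1..n} \<pi> \<phi>' v" by simp
    then have "\<pi> (\<phi> v) = \<pi> (\<phi>' v)" using v by (simp add: compose_def)
    moreover have "\<pi> (\<phi>' v) \<in> topspace Y" using \<pi> KX[OF that(2) v] by auto
    ultimately show "\<rho>Y ((\<pi> \<circ> \<phi>) v) ((\<pi> \<circ> \<phi>') v) \<le> \<theta>"
      using continuous_pseudometric_self[OF \<rho>Y] pos by simp
  qed
  have le: "ereal (card E) \<le> sep_number n \<pi> \<rho>X \<rho>Y M \<epsilon> \<theta>" if "sep E" for E
    unfolding sep_number_def
  proof (rule Sup_upper, intro CollectI exI conjI)
    show "\<forall>\<phi>\<in>E. \<forall>\<phi>'\<in>E. \<phi> \<noteq> \<phi>' \<longrightarrow>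
        rho_inf n \<rho>Y (\<pi> \<circ> \<phi>) (\<pi> \<circ> \<phi>') \<le> \<theta> \<and> \<epsilon> \<le> rho_inf n \<rho>X \<phi> \<phi>'"
      using that Y unfolding sep_def by blast
  qed (use that K in \<open>auto simp: sep_def\<close>)
  \<comment> \<open>With all cardinalities bounded, a separated set of greatest cardinality exists;
    \<open>Suc\<close> makes the bound strict.\<close>
  have bound: "\<forall>E. sep E \<longrightarrow> card E < Suc (nat \<lfloor>B\<rfloor>)"
    using order_trans[OF le fin] by (simp add: le_nat_floor less_Suc_eq_le)
  have "sep {}" by (simp add: sep_def)
  from ex_has_greatest_nat[OF this bound] obtain E
    where E: "sep E" and max: "\<forall>E'. sep E' \<longrightarrow> card E' \<le> card E"
    by (elim exE conjE)
  have "\<exists>e\<in>E. \<forall>v\<in>{1..n}. \<rho>X (\<phi> v) (e v) < \<epsilon>" if \<phi>: "\<phi> \<in> K" for \<phi>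
  proof (rule ccontr)
    assume "\<not> ?thesis"
    then have far: "\<epsilon> \<le> rho_inf n \<rho>X \<phi> e" if "e \<in> E" for e
      using rho_inf_less_iff[OF n, of \<rho>X \<phi> e \<epsilon>] that by auto
    have "rho_inf n \<rho>X \<phi> \<phi> < \<epsilon>"
      unfolding rho_inf_less_iff[OF n] using KX[OF \<phi>] continuous_pseudometric_self[OF \<rho>X] pos by auto
    then have "\<phi> \<notin> E" using far by force
    have sym: "rho_inf n \<rho>X e \<phi> = rho_inf n \<rho>X \<phi> e" if "e \<in> E" for e
    proof -
      have "e \<in> K" using that E by (auto simp: sep_def)
      then have "\<rho>X (e v) (\<phi> v) = \<rho>X (\<phi> v) (e v)" if "v \<in> {1..n}" for v
        using that by (intro continuous_pseudometricD(2)[OF \<rho>X] KX \<phi>)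
      then have "(\<lambda>v. \<rho>X (e v) (\<phi> v)) ` {1..n} = (\<lambda>v. \<rho>X (\<phi> v) (e v)) ` {1..n}"
        by (rule image_cong[OF refl])
      then show ?thesis unfolding rho_inf_def by simp
    qed
    have "sep (insert \<phi> E)"
      unfolding sep_def
    proof (intro conjI ballI impI)
      show "finite (insert \<phi> E)" "insert \<phi> E \<subseteq> K" using E \<phi> by (auto simp: sep_def)
      fix a b assume ab: "a \<in> insert \<phi> E" "b \<in> insert \<phi> E" "a \<noteq> b"
      consider "a \<in> E" "b \<in> E" | "a = \<phi>" "b \<in> E" | "a \<in> E" "b = \<phi>" using ab by blast
      then show "\<epsilon> \<le> rho_inf n \<rho>X a b"
      proof cases
        case 1
        then show ?thesis using E ab(3) by (simp add: sep_def)
      next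
        case 2
        then show ?thesis using far by simp
      next
        case 3
        then show ?thesis using far sym[of a] by simp
      qed
    qed
    from max[rule_format, OF this] show False using \<open>\<phi> \<notin> E\<close> E by (simp add: sep_def)
  qed
  then show ?thesis using E le[OF E] by (auto simp: sep_def)
qed

text \<open>Singletons are separated. With \<open>log_ereal_nonneg\<close> this keeps the normalised
  logarithms nonnegative.\<close>

lemma sep_number_ge_1:
  assumes "M \<noteq> {}"
  shows "1 \<le> sep_number n \<pi> \<rho>X \<rho>Y M \<epsilon> \<theta>"
proof -
  obtain \<phi> where "\<phi> \<in> M" using assms by auto
  then have "ereal (real (card {\<phi>})) \<le> sep_number n \<pi> \<rho>X \<rho>Y M \<epsilon> \<theta>"
    unfolding sep_number_def by (intro Sup_upper CollectI exI[of _ "{\<phi>}"]) auto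
  then show ?thesis by (simp add: one_ereal_def)
qed

lemma log_ereal_nonneg: "1 \<le> x \<Longrightarrow> 0 \<le> log_ereal x"
  by (cases x) (auto simp: log_ereal_def one_ereal_def zero_ereal_def)

lemma scaled_log_ereal_less:
  assumes n: "n > 0" and less: "ereal (1 / real n) * log_ereal x < ereal c" and k: "ereal (real k) \<le> x" "k > 0"
  shows "ln (real k) < real n * c"
proof -
  obtain b where x: "x = ereal b"
    using less n k by (cases x) (auto simp: log_ereal_def)
  have b: "real k \<le> b" "b > 0" using k x by auto
  then have "1 / real n * ln b < c" using less x by (simp add: log_ereal_def)
  then have "ln b < real n * c" using n by (simp add: field_simps)
  moreover have "ln (real k) \<le> ln b" using b k by simp
  ultimately show ?thesis by linarith
qed

lemma log_ereal_less_imp_finite: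
  assumes "n > 0" "ereal (1 / real n) * log_ereal x < ereal c"
  shows "\<exists>b. x \<le> ereal b"
  using assms by (cases x) (auto simp: log_ereal_def)

text \<open>Turns the entropy bound \<open>sep\<close> into the counting hypothesis of
  \<open>Wdim_fibre_le\<close>, of which \<open>D(2)\<close> is the logarithmic form per position.
  The summand \<open>D1\<close> pays for the windows, the one with \<open>\<kappa>\<close> for the
  positions where equivariance fails.\<close>

lemma Wdim_fibre_Map_le:
  fixes \<alpha> :: "'g \<Rightarrow> 'x \<Rightarrow> 'x" and \<tau> :: "'g \<Rightarrow> nat \<Rightarrow> nat"
  assumes \<rho>: "continuous_pseudometric X \<rho>" and \<rho>X: "continuous_pseudometric X \<rho>X"
    and \<rho>Y: "continuous_pseudometric Y \<rho>Y" and \<pi>: "\<pi> ` topspace X \<subseteq> topspace Y"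
    and F: "finite F" "F \<subseteq> G" and \<alpha>: "\<And>s. s \<in> F \<Longrightarrow> continuous_map X X (\<alpha> s)"
    and \<tau>: "\<And>s v. s \<in> F \<Longrightarrow> v \<in> {1..n} \<Longrightarrow> \<tau> s v \<in> {1..n}"
    and r: "r > 0" and gen: "\<And>x x'. \<lbrakk>x \<in> topspace X; x' \<in> topspace X;
      \<And>s. s \<in> F \<Longrightarrow> \<rho>X (\<alpha> s x) (\<alpha> s x') < 5 * r\<rbrakk> \<Longrightarrow> \<rho> x x' < \<epsilon>"
    and A: "finite A" "A \<subseteq> topspace X" "\<And>x. x \<in> topspace X \<Longrightarrow> \<exists>a\<in>A. \<rho>X x a < r"
    and A': "finite A'" "A' \<subseteq> topspace X"
      "\<And>x. x \<in> topspace X \<Longrightarrow> \<exists>a\<in>A'. \<rho> x a < min \<epsilon> 1 / 2"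
    and n: "n > 0"
    and K: "K \<subseteq> fibre X \<pi> n \<psi>" "K \<subseteq> Map_sofic X \<alpha> \<rho>X G \<delta> n \<tau>" "K \<subseteq> M"
    and \<delta>: "\<delta> \<ge> 0" "real (card F) * \<delta>\<^sup>2 \<le> \<kappa> * r\<^sup>2"
    and \<epsilon>': "0 < \<epsilon>'" "\<epsilon>' \<le> r / 4" and \<theta>: "\<theta> > 0"
    and sep: "ereal (1 / real n) * log_ereal (sep_number n \<pi> \<rho>X \<rho>Y M \<epsilon>' \<theta>)
      < ereal (D0 * ln (1 / \<epsilon>'))"
    and D: "0 \<le> D1" "card A * ln 2 + D0 * ln (1 / \<epsilon>') \<le> D1 * (ln (r / 8) + ln (1 / \<epsilon>'))"
  shows "Wdim \<epsilon> (subtopology (power_space X n) K) (rho_inf n \<rho>)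
           \<le> ereal (real n * (D1 + \<kappa> * (1 + real (card A'))))"
proof -
  \<comment> \<open>The largest \<open>L\<close> with
    \<open>\<epsilon>' / r \<le> 1 / (4 * L)\<close>. As \<open>L\<close> is at least 1, rounding
    down loses at most a factor 2, whence the 8 in \<open>D(2)\<close>.\<close>
  define L where "L = nat \<lfloor>r / (4 * \<epsilon>')\<rfloor>"
  define m where "m = nat \<lfloor>real n * D1\<rfloor>"
  define p where "p = nat \<lfloor>real n * \<kappa>\<rfloor>"
  have one: "1 \<le> r / (4 * \<epsilon>')" using \<epsilon>' by (simp add: field_simps)
  have Lf: "real L = of_int \<lfloor>r / (4 * \<epsilon>')\<rfloor>"
    using one unfolding L_def by (simp add: le_floor_iff)
  then have L1: "1 \<le> real L" "real L \<le> r / (4 * \<epsilon>')" using one by (auto simp: le_floor_iff)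
  have "r / (4 * \<epsilon>') < real L + 1" using Lf by linarith
  then have L2: "r / (8 * \<epsilon>') \<le> real L" using L1(1) by (simp add: field_simps)
  have L0: "L > 0" using L1(1) by (cases L) auto
  \<comment> \<open>The exponent \<open>m + 1\<close> in the count makes up for rounding
    \<open>n * D1\<close> down.\<close>
  have "real n * D1 < real m + 1" unfolding m_def using D(1) by linarith
  have \<kappa>: "\<kappa> \<ge> 0"
  proof -
    have "0 \<le> \<kappa> * r\<^sup>2" using \<delta>(2) by (smt (verit) mult_nonneg_nonneg of_nat_0_le_iff zero_le_power2)
    then show ?thesis using r by (simp add: zero_le_mult_iff)
  qed
  obtain b where b: "sep_number n \<pi> \<rho>X \<rho>Y M \<epsilon>' \<theta> \<le> ereal b"
    using log_ereal_less_imp_finite[OF n sep] by auto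
  from fibre_net[OF \<rho>X \<rho>Y \<pi> n K(1,3) \<epsilon>'(1) \<theta> b] obtain E where E: "finite E" "E \<subseteq> K"
    "ereal (card E) \<le> sep_number n \<pi> \<rho>X \<rho>Y M \<epsilon>' \<theta>"
    and net: "\<forall>\<phi>\<in>K. \<exists>e\<in>E. \<forall>v\<in>{1..n}. \<rho>X (\<phi> v) (e v) < \<epsilon>'"
    by (elim exE conjE)
  have count: "card E * 2 ^ (n * card A) < L ^ (m + 1)"
  proof (cases "card E = 0")
    case True
    then show ?thesis using L0 by simp
  next
    case False
    have "ln (real (card E * 2 ^ (n * card A))) = ln (real (card E)) + real n * (card A * ln 2)"
      using False by (simp add: ln_mult ln_realpow)
    also have "\<dots> < real n * (D0 * ln (1 / \<epsilon>')) + real n * (card A * ln 2)"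
      using scaled_log_ereal_less[OF n sep E(3)] False by simp
    also have "\<dots> = real n * (card A * ln 2 + D0 * ln (1 / \<epsilon>'))" by (simp add: algebra_simps)
    also have "\<dots> \<le> real n * (D1 * (ln (r / 8) + ln (1 / \<epsilon>')))"
      by (intro mult_left_mono D(2)) simp
    also have "ln (r / 8) + ln (1 / \<epsilon>') = ln (r / (8 * \<epsilon>'))"
      using r \<epsilon>' by (simp add: ln_div ln_mult)
    also have "real n * (D1 * ln (r / (8 * \<epsilon>'))) \<le> real n * (D1 * ln (real L))"
      using L2 r \<epsilon>' D(1) by (intro mult_left_mono ln_mono) auto
    also have "\<dots> = (real n * D1) * ln (real L)" by simp
    also have "\<dots> \<le> (real m + 1) * ln (real L)"
      using \<open>real n * D1 < real m + 1\<close> L1(1) by (intro mult_right_mono) auto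
    also have "\<dots> = ln (real (L ^ (m + 1)))" using L0 by (simp add: ln_mult ln_realpow algebra_simps)
    finally have "real (card E * 2 ^ (n * card A)) < real (L ^ (m + 1))"
      using False L0 by (subst (asm) ln_less_cancel_iff) auto
    then show ?thesis by (simp only: of_nat_less_iff)
  qed
  have bad: "card {v \<in> {1..n}. \<exists>s\<in>F. r < \<rho>X (\<alpha> s (\<phi> v)) (\<phi> (\<tau> s v))} \<le> p"
    if \<phi>: "\<phi> \<in> K" for \<phi>
  proof -
    \<comment> \<open>Chebyshev with \<open>t = r\<close> for each \<open>s\<close>, then a union
      bound over \<open>F\<close>; \<open>\<delta>(2)\<close> makes the total at most
      \<open>n * \<kappa>\<close>.\<close>
    let ?B = "\<lambda>s. {v \<in> {1..n}. r < \<rho>X (\<alpha> s (\<phi> v)) ((\<phi> \<circ> \<tau> s) v)}"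
    have "{v \<in> {1..n}. \<exists>s\<in>F. r < \<rho>X (\<alpha> s (\<phi> v)) (\<phi> (\<tau> s v))} = (\<Union>s\<in>F. ?B s)" by auto
    then have "real (card {v \<in> {1..n}. \<exists>s\<in>F. r < \<rho>X (\<alpha> s (\<phi> v)) (\<phi> (\<tau> s v))}) * r\<^sup>2
      \<le> real (\<Sum>s\<in>F. card (?B s)) * r\<^sup>2"
      using card_UN_le[OF F(1), of ?B] by (intro mult_right_mono) (auto simp del: of_nat_sum)
    also have "\<dots> = (\<Sum>s\<in>F. card (?B s) * r\<^sup>2)" by (simp add: sum_distrib_right)
    also have "\<dots> \<le> (\<Sum>s\<in>F. real n * \<delta>\<^sup>2)"
    proof (rule sum_mono)
      fix s assume "s \<in> F"
      then have "rho_2 n \<rho>X (\<lambda>v. \<alpha> s (\<phi> v)) (\<phi> \<circ> \<tau> s) \<le> \<delta>"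
        using \<phi> K(2) F(2) by (auto simp: Map_sofic_def)
      from rho_2_chebyshev[OF n \<delta>(1) r this] show "card (?B s) * r\<^sup>2 \<le> real n * \<delta>\<^sup>2" .
    qed
    also have "\<dots> = real n * (real (card F) * \<delta>\<^sup>2)" by simp
    also have "\<dots> \<le> real n * (\<kappa> * r\<^sup>2)" by (intro mult_left_mono \<delta>(2)) simp
    finally have "real (card {v \<in> {1..n}. \<exists>s\<in>F. r < \<rho>X (\<alpha> s (\<phi> v)) (\<phi> (\<tau> s v))}) \<le> real n * \<kappa>"
      using r by (simp add: mult.assoc[symmetric])
    then show ?thesis unfolding p_def by (simp add: le_nat_floor)
  qed
  have quot: "\<epsilon>' / r \<le> 1 / (4 * real L)"
    using L1 \<epsilon>'(1) r by (simp add: field_simps)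
  have KX: "K \<subseteq> topspace (power_space X n)" using K(1) by (auto simp: fibre_def)
  have "Wdim \<epsilon> (subtopology (power_space X n) K) (rho_inf n \<rho>)
      \<le> ereal (real (m + p * (1 + card A')))"
    by (rule Wdim_fibre_le[OF \<rho> \<rho>X F(1) \<alpha> \<tau> r gen A A' n KX E(1,2) bspec[OF net] L0 quot count bad])
  also have "real (m + p * (1 + card A')) \<le> real n * D1 + (real n * \<kappa>) * (1 + real (card A'))"
  proof -
    have "real m \<le> real n * D1" unfolding m_def using D(1) by (simp add: of_nat_floor)
    moreover have "real p \<le> real n * \<kappa>" unfolding p_def using \<kappa> by (simp add: of_nat_floor)
    then have "real p * (1 + real (card A')) \<le> (real n * \<kappa>) * (1 + real (card A'))"
      by (rule mult_right_mono) simp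
    ultimately show ?thesis by (simp only: of_nat_add of_nat_mult of_nat_1 add_mono)
  qed
  also have "\<dots> = real n * (D1 + \<kappa> * (1 + real (card A')))" by (simp add: algebra_simps)
  finally show ?thesis by simp
qed

section \<open>The inequality\<close>

lemma eventually_small_at_right:
  fixes T :: real
  assumes "c > 0"
  shows "\<forall>\<^sub>F \<epsilon> in at_right 0. 0 < \<epsilon> \<and> \<epsilon> < c \<and> T < ln (1 / \<epsilon>)"
proof (rule eventually_at_rightI[of 0 "min c (exp (- T))"])
  fix \<epsilon> assume "\<epsilon> \<in> {0<..<min c (exp (- T))}"
  moreover from this have "ln \<epsilon> < ln (exp (- T))" by (subst ln_less_cancel_iff) auto
  ultimately show "0 < \<epsilon> \<and> \<epsilon> < c \<and> T < ln (1 / \<epsilon>)" by (simp add: ln_div)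
qed (use assms in auto)

lemma Map_sofic_mono:
  assumes "F \<subseteq> G" "\<delta> \<le> \<delta>'"
  shows "Map_sofic X \<alpha> \<rho> G \<delta> n \<tau> \<subseteq> Map_sofic X \<alpha> \<rho> F \<delta>' n \<tau>"
  using assms unfolding Map_sofic_def by force

text \<open>Any \<open>D\<close> above the right side leaves room for \<open>D0 < D1 < D\<close>.
  For small \<open>\<epsilon>'\<close> the gap \<open>D1 - D0\<close> absorbs the constants of the
  random choice, and the gap \<open>D - D1\<close> absorbs the coordinates where equivariance
  fails.\<close>

lemma mdim_sofic_le_cond_metric_mdim:
  fixes \<Gamma> :: "('g, 'm) monoid_scheme" and X :: "'x topology" and Y :: "'y topology"
  assumes \<Sigma>: "sofic_approximation \<Gamma> d \<sigma>" and X: "dynamical_system \<Gamma> X \<alpha>"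
    and \<pi>: "\<pi> ` topspace X \<subseteq> topspace Y"
    and \<rho>: "compatible_metric X \<rho>"
    and \<rho>X: "continuous_pseudometric X \<rho>X" and gen: "dynamically_generating \<Gamma> X \<alpha> \<rho>X"
    and \<rho>Y: "continuous_pseudometric Y \<rho>Y"
  shows "mdim_sofic \<Gamma> d \<sigma> X \<alpha> Y \<pi> \<rho> \<le> cond_metric_mdim \<Gamma> d \<sigma> X \<alpha> \<pi> \<rho>X \<rho>Y"
proof (rule dense_ge)
  fix D' assume D': "cond_metric_mdim \<Gamma> d \<sigma> X \<alpha> \<pi> \<rho>X \<rho>Y < D'"
  have cX: "compact_space X" and \<alpha>: "\<And>s. s \<in> carrier \<Gamma> \<Longrightarrow> continuous_map X X (\<alpha> s)"
    using X by (auto simp: dynamical_system_def)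
  have \<sigma>: "\<sigma> i s v \<in> {1..d i}" if "s \<in> carrier \<Gamma>" "v \<in> {1..d i}" for i s v
    using \<Sigma> that permutes_in_image[of "\<sigma> i s" "{1..d i}" v] by (auto simp: sofic_approximation_def)
  have cp: "continuous_pseudometric X \<rho>"
    by (rule compatible_metric_imp_continuous_pseudometric[OF \<rho>])
  show "mdim_sofic \<Gamma> d \<sigma> X \<alpha> Y \<pi> \<rho> \<le> D'"
  proof (cases D')
    case PInf
    then show ?thesis by simp
  next
    case MInf
    then show ?thesis using D' by simp
  next
    case (real D)
    obtain D0 where D0: "cond_metric_mdim \<Gamma> d \<sigma> X \<alpha> \<pi> \<rho>X \<rho>Y < ereal D0" "D0 < D"
      using ereal_dense2[OF D'] real by auto
    define D1 where "D1 = (D0 + D) / 2"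
    have D1: "D0 < D1" "D1 < D" using D0(2) unfolding D1_def by auto
    show ?thesis
      unfolding mdim_sofic_def
    proof (rule SUP_least)
      fix \<epsilon> :: real assume "\<epsilon> \<in> {0<..}"
      then have \<epsilon>: "\<epsilon> > 0" by simp
      obtain Fg e where Fg: "finite Fg" "Fg \<subseteq> carrier \<Gamma>" and e: "0 < e"
        and gen': "\<And>x y. x \<in> topspace X \<Longrightarrow> y \<in> topspace X \<Longrightarrow>
          (\<And>s. s \<in> Fg \<Longrightarrow> \<rho>X (\<alpha> s x) (\<alpha> s y) < e) \<Longrightarrow> \<rho> x y < \<epsilon>"
        using dynamically_generating_witness[OF cX \<rho> \<rho>X gen \<alpha> \<epsilon>] by metis
      define r where "r = e / 5"
      have r: "r > 0" using e by (simp add: r_def)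
      from pseudometric_finite_net[OF cX \<rho>X r] obtain A where A: "finite A" "A \<subseteq> topspace X"
        and net: "\<forall>x\<in>topspace X. \<exists>a\<in>A. \<rho>X x a < r"
        by (elim exE conjE)
      have "min \<epsilon> 1 / 2 > 0" using \<epsilon> by simp
      from pseudometric_finite_net[OF cX cp this]
      obtain A' where A': "finite A'" "A' \<subseteq> topspace X"
        and net': "\<forall>x\<in>topspace X. \<exists>a\<in>A'. \<rho> x a < min \<epsilon> 1 / 2"
        by (elim exE conjE)
      \<comment> \<open>The proportion of positions whose \<open>1 + card A'\<close> further
        coordinates exactly use up the gap \<open>D - D1\<close>.\<close>
      define \<kappa> where "\<kappa> = (D - D1) / (1 + real (card A'))"
      have \<kappa>: "\<kappa> > 0" "D1 + \<kappa> * (1 + real (card A')) = D"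
        using D1(2) unfolding \<kappa>_def by (auto simp: field_simps)
      \<comment> \<open>The threshold obtained by solving \<open>Dineq\<close> for
        \<open>ln (1 / \<epsilon>')\<close>.\<close>
      define T where "T = (real (card A) * ln 2 - D1 * ln (r / 8)) / (D1 - D0)"
      let ?f = "\<lambda>\<epsilon>'. cond_entropy_eps \<Gamma> d \<sigma> X \<alpha> \<pi> \<rho>X \<rho>Y \<epsilon>' / ereal (ln (1 / \<epsilon>'))"
      \<comment> \<open>A lower limit below \<open>D0\<close> only yields values below
        \<open>D0\<close> frequently, which is enough to combine with the eventual conditions on
        \<open>\<epsilon>'\<close>.\<close>
      have "\<not> (\<forall>\<^sub>F \<epsilon>' in at_right 0. ereal D0 \<le> ?f \<epsilon>')"
        using Liminf_bounded[of "ereal D0" ?f "at_right 0"] D0(1)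
        by (auto simp: cond_metric_mdim_def)
      then have freq_f: "\<exists>\<^sub>F \<epsilon>' in at_right 0. ?f \<epsilon>' < ereal D0"
        by (simp add: not_eventually not_le)
      have ev_\<epsilon>: "\<forall>\<^sub>F \<epsilon>' in at_right 0. 0 < \<epsilon>' \<and> \<epsilon>' < min 1 (r / 4) \<and> T < ln (1 / \<epsilon>')"
        by (rule eventually_small_at_right) (use r in simp)
      from frequently_ex[OF frequently_eventually_conj[OF freq_f ev_\<epsilon>]]
      obtain \<epsilon>' where \<epsilon>'_pos: "0 < \<epsilon>'" and \<epsilon>'_less: "\<epsilon>' < min 1 (r / 4)"
        and \<epsilon>'_T: "T < ln (1 / \<epsilon>')" and f: "?f \<epsilon>' < ereal D0"
        by (elim exE conjE)
      then have \<epsilon>': "0 < \<epsilon>'" "\<epsilon>' < 1" "\<epsilon>' \<le> r / 4" "T < ln (1 / \<epsilon>')" by auto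
      define l where "l = ln (1 / \<epsilon>')"
      have l: "l > 0" using \<epsilon>' unfolding l_def by simp
      have "real (card A) * ln 2 - D1 * ln (r / 8) \<le> l * (D1 - D0)"
        using \<epsilon>'(4) D1(1) unfolding T_def l_def by (simp add: divide_less_eq)
      then have Dineq: "real (card A) * ln 2 + D0 * ln (1 / \<epsilon>') \<le> D1 * (ln (r / 8) + ln (1 / \<epsilon>'))"
        unfolding l_def by (simp add: algebra_simps)
      have "cond_entropy_eps \<Gamma> d \<sigma> X \<alpha> \<pi> \<rho>X \<rho>Y \<epsilon>' < ereal (D0 * l)"
        using f l unfolding l_def[symmetric] by (simp add: ereal_divide_less_iff)
      then obtain \<theta> F1 \<delta>1 where \<theta>: "\<theta> > 0" and F1: "F1 \<in> finite_subsets \<Gamma>" and \<delta>1: "\<delta>1 > 0"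
        and ent: "limsup_conv (\<lambda>i. Map_sofic X \<alpha> \<rho>X F1 \<delta>1 (d i) (\<sigma> i))
          (\<lambda>i. ereal (1 / real (d i)) * log_ereal (sep_number (d i) \<pi> \<rho>X \<rho>Y
             (Map_sofic X \<alpha> \<rho>X F1 \<delta>1 (d i) (\<sigma> i)) \<epsilon>' \<theta>)) < ereal (D0 * l)"
        unfolding cond_entropy_eps_def INF_less_iff by auto
      define M where "M i = Map_sofic X \<alpha> \<rho>X F1 \<delta>1 (d i) (\<sigma> i)" for i
      define a where "a i = ereal (1 / real (d i)) *
        log_ereal (sep_number (d i) \<pi> \<rho>X \<rho>Y (M i) \<epsilon>' \<theta>)" for i
      \<comment> \<open>The first term leads into the sets \<open>M i\<close> of the entropy bound,
        the second is for the Chebyshev count. The \<open>1 +\<close> keeps the quotient positive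
        when \<open>Fg\<close> is empty.\<close>
      define \<delta> where "\<delta> = min \<delta>1 (r * sqrt (\<kappa> / (1 + real (card Fg))))"
      have \<delta>: "\<delta> > 0" using \<delta>1 r \<kappa>(1) unfolding \<delta>_def by simp
      have card\<delta>: "real (card Fg) * \<delta>\<^sup>2 \<le> \<kappa> * r\<^sup>2"
      proof -
        have "\<delta>\<^sup>2 \<le> (r * sqrt (\<kappa> / (1 + real (card Fg))))\<^sup>2"
          using \<delta> by (intro power_mono) (auto simp: \<delta>_def)
        then have "\<delta>\<^sup>2 \<le> r\<^sup>2 * (\<kappa> / (1 + real (card Fg)))"
          using \<kappa>(1) by (simp add: power_mult_distrib)
        then have "(1 + real (card Fg)) * \<delta>\<^sup>2 \<le> \<kappa> * r\<^sup>2" by (simp add: field_simps)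
        then show ?thesis using zero_le_power2[of \<delta>] unfolding distrib_right by linarith
      qed
      define F' where "F' = F1 \<union> Fg"
      have F': "F' \<in> finite_subsets \<Gamma>" using F1 Fg by (auto simp: finite_subsets_def F'_def)
      obtain \<delta>' where \<delta>': "\<delta>' > 0" and sub: "\<And>F n \<tau>. n > 0 \<Longrightarrow>
        (\<forall>s\<in>F. \<alpha> s ` topspace X \<subseteq> topspace X \<and> \<tau> s ` {1..n} \<subseteq> {1..n}) \<Longrightarrow>
        Map_sofic X \<alpha> \<rho> F \<delta>' n \<tau> \<subseteq> Map_sofic X \<alpha> \<rho>X F \<delta> n \<tau>"
        using Map_sofic_subset[OF cX \<rho> \<rho>X \<delta>, of \<alpha>] by metis
      define M' where "M' i = Map_sofic X \<alpha> \<rho> F' \<delta>' (d i) (\<sigma> i)" for i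
      have M'sub: "M' i \<subseteq> Map_sofic X \<alpha> \<rho>X F' \<delta> (d i) (\<sigma> i)" if "d i > 0" for i
        unfolding M'_def
      proof (rule sub[OF that], intro ballI conjI)
        fix s assume "s \<in> F'"
        then have s: "s \<in> carrier \<Gamma>" using F' by (auto simp: finite_subsets_def)
        show "\<alpha> s ` topspace X \<subseteq> topspace X"
          using \<alpha>[OF s] by (auto simp: continuous_map_def)
        show "\<sigma> i s ` {1..d i} \<subseteq> {1..d i}" using \<sigma>[OF s] by blast
      qed
      moreover have "Map_sofic X \<alpha> \<rho>X F' \<delta> (d i) (\<sigma> i) \<subseteq> M i" for i
        unfolding M_def F'_def by (rule Map_sofic_mono) (auto simp: \<delta>_def)
      ultimately have M'M: "M' i \<subseteq> M i" if "d i > 0" for i using that by blast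
      have ev_d: "\<forall>\<^sub>F i in sequentially. d i > 0"
      proof -
        have "filterlim d at_top sequentially" using \<Sigma> by (simp add: sofic_approximation_def)
        then have "\<forall>\<^sub>F i in sequentially. 1 \<le> d i" unfolding filterlim_at_top by blast
        then show ?thesis by (rule eventually_mono) simp
      qed
      let ?w = "\<lambda>i. ereal (1 / real (d i)) * (SUP \<psi>\<in>topspace (power_space Y (d i)).
        Wdim \<epsilon> (subtopology (power_space X (d i)) (M' i \<inter> fibre X \<pi> (d i) \<psi>)) (rho_inf (d i) \<rho>))"
      have "limsup_conv M' ?w \<le> D'"
      proof (cases "\<forall>\<^sub>F i in sequentially. M' i = {}")
        case True
        then show ?thesis by (simp add: limsup_conv_def)
      next
        case False
        then have "\<exists>\<^sub>F i in sequentially. d i > 0 \<and> M' i \<noteq> {}"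
          using ev_d by (simp add: not_eventually frequently_eventually_conj)
        then have freq: "\<exists>\<^sub>F i in sequentially. M i \<noteq> {}"
          by (rule frequently_mono[rotated]) (use M'M in blast)
        \<comment> \<open>The sets \<open>M i\<close> are nonempty infinitely often, so the
          convention for empty sets does not apply.\<close>
        then have "limsup_conv M a = limsup a"
          by (simp add: limsup_conv_def frequently_def)
        then have "limsup a < ereal (D0 * l)" using ent by (simp add: M_def[abs_def] a_def[abs_def])
        then have ev_a: "\<forall>\<^sub>F i in sequentially. a i < ereal (D0 * l)" by (rule Limsup_lessD)
        from frequently_ex[OF frequently_eventually_conj[OF freq ev_a]]
        obtain j where aj: "a j < ereal (D0 * l)" and "M j \<noteq> {}"
          by (elim exE conjE)
        \<comment> \<open>A nonempty \<open>M j\<close> makes \<open>a j\<close> nonnegative, hence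
          \<open>D0\<close> positive; this gives the sign condition on \<open>D1\<close> in
          \<open>Wdim_fibre_Map_le\<close>.\<close>
        then have "0 \<le> log_ereal (sep_number (d j) \<pi> \<rho>X \<rho>Y (M j) \<epsilon>' \<theta>)"
          by (intro log_ereal_nonneg sep_number_ge_1)
        then have "0 \<le> a j" unfolding a_def by (intro ereal_0_le_mult) auto
        then have "0 < ereal (D0 * l)" using aj by (rule le_less_trans)
        then have "D0 > 0" using l by (simp add: zero_less_mult_iff)
        then have D1_nonneg: "0 \<le> D1" using D1(1) by simp
        have "\<forall>\<^sub>F i in sequentially. ?w i \<le> D'"
          using ev_a ev_d
        proof eventually_elim
          case (elim i)
          have "(SUP \<psi>\<in>topspace (power_space Y (d i)).
            Wdim \<epsilon> (subtopology (power_space X (d i)) (M' i \<inter> fibre X \<pi> (d i) \<psi>)) (rho_inf (d i) \<rho>))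
            \<le> ereal (real (d i) * D)"
          proof (rule SUP_least)
            fix \<psi>
            have "Wdim \<epsilon> (subtopology (power_space X (d i)) (M' i \<inter> fibre X \<pi> (d i) \<psi>)) (rho_inf (d i) \<rho>)
              \<le> ereal (real (d i) * (D1 + \<kappa> * (1 + real (card A'))))"
            proof (rule Wdim_fibre_Map_le[OF cp \<rho>X \<rho>Y \<pi> Fg(1), where M = "M i" and ?D0.0 = D0
                  and \<epsilon>' = \<epsilon>' and \<theta> = \<theta> and \<delta> = \<delta> and G = F' and r = r and A = A])
              show "Fg \<subseteq> F'" by (simp add: F'_def)
              show "M' i \<inter> fibre X \<pi> (d i) \<psi> \<subseteq> Map_sofic X \<alpha> \<rho>X F' \<delta> (d i) (\<sigma> i)"
                using M'sub[OF elim(2)] by blast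
              show "M' i \<inter> fibre X \<pi> (d i) \<psi> \<subseteq> M i" using M'M[OF elim(2)] by blast
              show "ereal (1 / real (d i)) * log_ereal (sep_number (d i) \<pi> \<rho>X \<rho>Y (M i) \<epsilon>' \<theta>)
                < ereal (D0 * ln (1 / \<epsilon>'))"
                using elim(1) by (simp only: a_def l_def)
              show "\<rho> x x' < \<epsilon>" if "x \<in> topspace X" "x' \<in> topspace X"
                "\<And>s. s \<in> Fg \<Longrightarrow> \<rho>X (\<alpha> s x) (\<alpha> s x') < 5 * r" for x x'
                using gen'[OF that(1,2)] that(3) by (simp add: r_def)
            qed (use Fg(2) \<alpha> \<sigma> r A A' net net' elim(2) \<delta> card\<delta> \<epsilon>' \<theta> D1_nonneg Dineq in auto)
            then show "Wdim \<epsilon> (subtopology (power_space X (d i)) (M' i \<inter> fibre X \<pi> (d i) \<psi>)) (rho_inf (d i) \<rho>)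
              \<le> ereal (real (d i) * D)" by (simp only: \<kappa>(2))
          qed
          then have "?w i \<le> ereal (1 / real (d i)) * ereal (real (d i) * D)"
            by (rule ereal_mult_left_mono) simp
          then show "?w i \<le> D'" using elim(2) real by simp
        qed
        then have "limsup ?w \<le> D'" by (rule Limsup_bounded)
        then show ?thesis using False by (simp add: limsup_conv_def)
      qed
      then show "(INF F\<in>finite_subsets \<Gamma>. INF \<delta>\<in>{0<..}.
        limsup_conv (\<lambda>i. Map_sofic X \<alpha> \<rho> F \<delta> (d i) (\<sigma> i))
          (\<lambda>i. ereal (1 / real (d i)) * (SUP \<psi>\<in>topspace (power_space Y (d i)).
            Wdim \<epsilon> (subtopology (power_space X (d i))
              (Map_sofic X \<alpha> \<rho> F \<delta> (d i) (\<sigma> i) \<inter> fibre X \<pi> (d i) \<psi>)) (rho_inf (d i) \<rho>)))) \<le> D'"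
        unfolding M'_def using F' \<delta>' by (intro INF_lower2[of F'] INF_lower2[of \<delta>']) auto
    qed
  qed
qed

section \<open>Finite conditional entropy and the two claims\<close>

text \<open>The numerator stays below a constant \<open>H\<close>, while
  \<open>ln (1 / \<epsilon>)\<close> tends to infinity.\<close>

lemma cond_metric_mdim_le_0:
  assumes fin: "cond_entropy \<Gamma> d \<sigma> X \<alpha> \<pi> \<rho>X \<rho>Y < \<infinity>"
  shows "cond_metric_mdim \<Gamma> d \<sigma> X \<alpha> \<pi> \<rho>X \<rho>Y \<le> 0"
proof (rule dense_ge)
  fix c :: ereal assume c: "0 < c"
  obtain H where "cond_entropy \<Gamma> d \<sigma> X \<alpha> \<pi> \<rho>X \<rho>Y \<le> ereal H"
    using fin by (metis ereal_dense2 less_imp_le)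
  then have H: "cond_entropy_eps \<Gamma> d \<sigma> X \<alpha> \<pi> \<rho>X \<rho>Y \<epsilon> \<le> ereal H" if "\<epsilon> > 0" for \<epsilon>
    unfolding cond_entropy_def SUP_le_iff using that by auto
  show "cond_metric_mdim \<Gamma> d \<sigma> X \<alpha> \<pi> \<rho>X \<rho>Y \<le> c"
  proof (cases c)
    case (real b)
    then have b: "b > 0" using c by simp
    \<comment> \<open>The 0 keeps the denominator positive, and \<open>H / b\<close> brings the
      quotient down to at most \<open>b\<close>.\<close>
    let ?T = "max 0 (H / b)"
    have "\<forall>\<^sub>F \<epsilon> in at_right 0. 0 < \<epsilon> \<and> \<epsilon> < 1 \<and> ?T < ln (1 / \<epsilon>)"
      by (rule eventually_small_at_right) simp
    then have "\<forall>\<^sub>F \<epsilon> in at_right 0.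
      cond_entropy_eps \<Gamma> d \<sigma> X \<alpha> \<pi> \<rho>X \<rho>Y \<epsilon> / ereal (ln (1 / \<epsilon>)) \<le> c"
    proof eventually_elim
      case (elim \<epsilon>)
      then have l: "0 < ln (1 / \<epsilon>)" "H / b < ln (1 / \<epsilon>)" by auto
      have "cond_entropy_eps \<Gamma> d \<sigma> X \<alpha> \<pi> \<rho>X \<rho>Y \<epsilon> / ereal (ln (1 / \<epsilon>))
          \<le> ereal H / ereal (ln (1 / \<epsilon>))"
        using H[of \<epsilon>] elim l by (intro ereal_divide_right_mono) auto
      also have "\<dots> = ereal (H / ln (1 / \<epsilon>))" using l by simp
      also have "\<dots> \<le> ereal b" using l b by (simp add: field_simps)
      finally show ?case using real by simp
    qed
    then show ?thesis unfolding cond_metric_mdim_def by (intro Liminf_le) auto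
  qed (use c in auto)
qed

text \<open>Already the identity of the group separates distinct points.\<close>

lemma compatible_metric_dynamically_generating:
  assumes \<Gamma>: "group \<Gamma>" and X: "dynamical_system \<Gamma> X \<alpha>" and \<rho>: "compatible_metric X \<rho>"
  shows "dynamically_generating \<Gamma> X \<alpha> \<rho>"
  unfolding dynamically_generating_def
proof (intro ballI impI)
  fix x x' assume x: "x \<in> topspace X" "x' \<in> topspace X" "x \<noteq> x'"
  interpret Metric_space "topspace X" \<rho> using \<rho> by (simp add: compatible_metric_def)
  interpret group_action \<Gamma> "topspace X" \<alpha> using X by (simp add: dynamical_system_def)
  interpret \<Gamma>: group \<Gamma> by (rule \<Gamma>)
  have "\<alpha> \<one>\<^bsub>\<Gamma>\<^esub> x = x" "\<alpha> \<one>\<^bsub>\<Gamma>\<^esub> x' = x'"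
    using x id_eq_one by (metis restrict_apply')+
  then have "0 < ereal (\<rho> (\<alpha> \<one>\<^bsub>\<Gamma>\<^esub> x) (\<alpha> \<one>\<^bsub>\<Gamma>\<^esub> x'))" using x by (simp add: mdist_pos_less)
  also have "\<dots> \<le> (SUP s\<in>carrier \<Gamma>. ereal (\<rho> (\<alpha> s x) (\<alpha> s x')))" by (rule SUP_upper) simp
  finally show "(SUP s\<in>carrier \<Gamma>. ereal (\<rho> (\<alpha> s x) (\<alpha> s x'))) > 0" .
qed

theorem theorem6p15:
  fixes \<Gamma> :: "('g, 'm) monoid_scheme"
    and d :: "nat \<Rightarrow> nat" and \<sigma> :: "nat \<Rightarrow> 'g \<Rightarrow> nat \<Rightarrow> nat"
    and X :: "'x topology" and \<alpha> :: "'g \<Rightarrow> 'x \<Rightarrow> 'x"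
    and Y :: "'y topology" and \<beta> :: "'g \<Rightarrow> 'y \<Rightarrow> 'y"
    and \<pi> :: "'x \<Rightarrow> 'y"
  assumes "group \<Gamma>" and "countable (carrier \<Gamma>)"
    and "sofic_approximation \<Gamma> d \<sigma>"
    and "dynamical_system \<Gamma> X \<alpha>" and "dynamical_system \<Gamma> Y \<beta>"
    and "factor_map \<Gamma> X \<alpha> Y \<beta> \<pi>"
  shows "(\<forall>\<rho> \<rho>X \<rho>Y.
            compatible_metric X \<rho> \<and> compatible_metric X \<rho>X \<and>
            continuous_pseudometric Y \<rho>Y \<and> dynamically_generating \<Gamma> Y \<beta> \<rho>Y \<longrightarrow>
            mdim_sofic \<Gamma> d \<sigma> X \<alpha> Y \<pi> \<rho> \<le> cond_metric_mdim \<Gamma> d \<sigma> X \<alpha> \<pi> \<rho>X \<rho>Y) \<and>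
         (\<forall>\<rho> \<rho>X \<rho>Y.
            compatible_metric X \<rho> \<and>
            continuous_pseudometric X \<rho>X \<and> dynamically_generating \<Gamma> X \<alpha> \<rho>X \<and>
            continuous_pseudometric Y \<rho>Y \<and> dynamically_generating \<Gamma> Y \<beta> \<rho>Y \<and>
            cond_entropy \<Gamma> d \<sigma> X \<alpha> \<pi> \<rho>X \<rho>Y < \<infinity> \<longrightarrow>
            mdim_sofic \<Gamma> d \<sigma> X \<alpha> Y \<pi> \<rho> \<le> 0)"
proof (intro conjI allI impI; elim conjE)
  have \<pi>: "\<pi> ` topspace X \<subseteq> topspace Y" using assms(6) by (simp add: factor_map_def)
  note le = mdim_sofic_le_cond_metric_mdim[OF assms(3,4) \<pi>]
  fix \<rho> \<rho>X \<rho>Y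
  assume \<rho>: "compatible_metric X \<rho>" and \<rho>Y: "continuous_pseudometric Y \<rho>Y"
  show "mdim_sofic \<Gamma> d \<sigma> X \<alpha> Y \<pi> \<rho> \<le> cond_metric_mdim \<Gamma> d \<sigma> X \<alpha> \<pi> \<rho>X \<rho>Y"
    if "compatible_metric X \<rho>X"
    using le[OF \<rho> _ _ \<rho>Y] that compatible_metric_imp_continuous_pseudometric
      compatible_metric_dynamically_generating[OF assms(1,4)] by blast
  \<comment> \<open>Here \<open>le\<close> is used for the generating pseudometric itself, and
    finite entropy makes its right side at most 0.\<close>
  show "mdim_sofic \<Gamma> d \<sigma> X \<alpha> Y \<pi> \<rho> \<le> 0"
    if "continuous_pseudometric X \<rho>X" "dynamically_generating \<Gamma> X \<alpha> \<rho>X"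
      "cond_entropy \<Gamma> d \<sigma> X \<alpha> \<pi> \<rho>X \<rho>Y < \<infinity>"
    using le[OF \<rho> that(1,2) \<rho>Y] cond_metric_mdim_le_0[OF that(3)] by (rule order_trans)
qed

end
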